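(* There exist universal constants $C_1',C_2'>0$ such that the following holds. Let $f:\mathbb{R}^k\times\mathbb{R}^m\to\mathbb{R}$ be a real-valued function, let $\mathcal{P}_{i,j}$ ($i,j\in[N]$) be probability distributions on $\mathbb{R}^m$, and let $\eta_{i,j}\sim\mathcal{P}_{i,j}$ be random vectors on a common probability space. Define $$\hat F_N(\theta)=\frac1{N^2}\sum_{i,j\in[N]}f(\theta,\eta_{i,j}),\qquad F_N(\theta)=\mathbb{E}\big[\hat F_N(\theta)\big],\qquad\theta\in\mathbb{R}^k,$$ where the expectation is over all randomness. Let $\mathcal{C}$ be a nonempty compact subset of $\mathbb{R}^k$ with diameter $D$. Suppose: 1. For $i_1,i_2,j_1,j_2\in[N]$, if $\{i_1\}\cup\{j_1\}$ and $\{i_2\}\cup\{j_2\}$ are disjoint, then $\eta_{i_1,j_1}$ and $\eta_{i_2,j_2}$ are independent. 2. $F_N$ and $\hat F_N$ have unique minimizers on $\mathcal{C}$, named $\theta_N^*$ and $\hat\theta_N^*$ respectively. 3. $F_N$ is $\alpha$-strongly convex on $\mathcal{C}$ ($\alpha>0$). 4. For all $\theta\in\mathcal{C}$ and $i,j\in[N]$, $\mathbb{E}_{\eta\sim\mathcal{P}_{i,j}}\big[e^{|f(\theta,\eta)-\mathbb{E}_{\eta\sim\mathcal{P}_{i,j}}[f(\theta,\eta)]|}\big]<M$. 5. There is a function $g:\mathbb{R}^m\to\mathbb{R}$ such that $\|\nabla_\theta f(\theta,\eta)\|\le g(\eta)$ for all $\theta\in\mathcal{C}$ and $\eta\in\mathbb{R}^m$;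 in addition, for all $\theta\in\mathcal{C}$ and $i,j\in[N]$, $\|\nabla_\theta\mathbb{E}_{\eta\sim\mathcal{P}_{i,j}}[f(\theta,\eta)]\|\le\mathbb{E}_{\eta\sim\mathcal{P}_{i,j}}[g(\eta)]$ and $\mathbb{E}_{\eta\sim\mathcal{P}_{i,j}}[e^{g(\eta)}]<L$. Then for each $0<\epsilon<\alpha^{-1/2}$ and $\delta\in(0,1)$, we have $\|\hat\theta_N^*-\theta_N^*\|<\epsilon$ with probability at least $1-\delta$ if $$N>\frac{C_1'M}{\alpha^2\epsilon^4}\log\left(\frac3\delta\max\left\{1,\left(\frac{C_2'k^{1/2}DL}{\alpha\epsilon^2}\right)^k\right\}\right).$$
   Context: $k,m,N\ge1$ are integers, $[N]=\{1,\dots,N\}$, and $\|\cdot\|$ is the Euclidean norm. "$F$ is $\alpha$-strongly convex on $\mathcal{C}$" has its usual meaning: $F(t\theta+(1-t)\theta')\le tF(\theta)+(1-t)F(\theta')-\frac{\alpha}{2}t(1-t)\|\theta-\theta'\|^2$ for $\theta,\theta'\in\mathcal{C}$, $t\in[0,1]$. "Universal" means independent of all other quantities. The gradients and expectations appearing in the hypotheses are understood to exist.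
   Formalization: Hypothesis 1 is taken as joint independence of every family of η_{i,j} with pairwise disjoint index sets, and C is assumed convex; the claim is false without either. The constants are stated per type of sample space, which yields uniform ones by passing to the joint law. *)

theory Defs
  imports "HOL-Probability.Probability"
begin

text \<open>
  The dimensions have to be quantified inside the statement, because the two constants must not
  depend on them; so they cannot be carried by types. All the spaces \<open>\<real>\<^sup>n\<close> are therefore realised as
  the subspaces \<open>Rn n\<close> (coordinates \<open>0, \<dots>, n - 1\<close>) of one inner product space, the finitely
  supported real sequences. (The library's instance for \<open>poly_mapping\<close> carries the
  sum norm instead of the Euclidean one.)
\<close>

typedef fseq = "{x :: nat \<Rightarrow> real. finite {i. x i \<noteq> 0}}"
  morphisms coord Abs_fseq
  by (rule exI[of _ "\<lambda>_. 0"]) simp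

setup_lifting type_definition_fseq

lemma finite_coord [simp]: "finite {i. coord x i \<noteq> 0}"
  using coord[of x] by simp

instantiation fseq :: real_vector
begin

lift_definition zero_fseq :: fseq is "\<lambda>_. 0" by simp

lift_definition plus_fseq :: "fseq \<Rightarrow> fseq \<Rightarrow> fseq" is "\<lambda>x y i. x i + y i"
  subgoal for x y
    by (rule finite_subset[of _ "{i. x i \<noteq> 0} \<union> {i. y i \<noteq> 0}"]) auto
  done

lift_definition uminus_fseq :: "fseq \<Rightarrow> fseq" is "\<lambda>x i. - x i" by simp

lift_definition minus_fseq :: "fseq \<Rightarrow> fseq \<Rightarrow> fseq" is "\<lambda>x y i. x i - y i"
  subgoal for x y
    by (rule finite_subset[of _ "{i. x i \<noteq> 0} \<union> {i. y i \<noteq> 0}"]) auto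
  done

lift_definition scaleR_fseq :: "real \<Rightarrow> fseq \<Rightarrow> fseq" is "\<lambda>r x i. r * x i"
  by (rule finite_subset[rotated]) auto

instance
  by standard (transfer, simp add: algebra_simps fun_eq_iff)+

end

lemma coord_simps [simp]:
  "coord 0 i = 0"
  "coord (x + y) i = coord x i + coord y i"
  "coord (- x) i = - coord x i"
  "coord (x - y) i = coord x i - coord y i"
  "coord (r *\<^sub>R x) i = r * coord x i"
  by (transfer, simp)+

lemma fseq_eqI: "(\<And>i. coord x i = coord y i) \<Longrightarrow> x = y"
  by (metis coord_inject ext)

definition Rn :: "nat \<Rightarrow> fseq set" where
  "Rn n = {x. \<forall>i\<ge>n. coord x i = 0}"

instantiation fseq :: real_inner
begin

definition inner_fseq :: "fseq \<Rightarrow> fseq \<Rightarrow> real" where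
  "inner_fseq x y = (\<Sum>i | coord x i \<noteq> 0. coord x i * coord y i)"

definition norm_fseq :: "fseq \<Rightarrow> real" where
  "norm_fseq x = sqrt (inner x x)"

definition dist_fseq :: "fseq \<Rightarrow> fseq \<Rightarrow> real" where
  "dist_fseq x y = norm (x - y)"

definition sgn_fseq :: "fseq \<Rightarrow> fseq" where
  "sgn_fseq x = x /\<^sub>R norm x"

definition uniformity_fseq :: "(fseq \<times> fseq) filter" where
  "uniformity_fseq = (INF e\<in>{0<..}. principal {(x, y). dist x y < e})"

definition open_fseq :: "fseq set \<Rightarrow> bool" where
  "open_fseq U \<longleftrightarrow> (\<forall>x\<in>U. \<forall>\<^sub>F (x', y) in uniformity. x' = x \<longrightarrow> y \<in> U)"

lemma inner_fseq_superset:
  assumes "finite A" "{i. coord x i \<noteq> 0} \<subseteq> A"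
  shows "inner x y = (\<Sum>i\<in>A. coord x i * coord y i)"
  unfolding inner_fseq_def using assms by (intro sum.mono_neutral_left) auto

instance
proof
  fix x y z :: fseq and r :: real
  define A where "A = {i. coord x i \<noteq> 0} \<union> {i. coord y i \<noteq> 0}"
  have A: "finite A" "{i. coord x i \<noteq> 0} \<subseteq> A" "{i. coord y i \<noteq> 0} \<subseteq> A"
      "{i. coord (x + y) i \<noteq> 0} \<subseteq> A" "{i. coord (r *\<^sub>R x) i \<noteq> 0} \<subseteq> A"
    by (auto simp: A_def)
  note E = A(2-5)[THEN inner_fseq_superset[OF A(1)]]
  show "inner x y = inner y x"
    by (simp add: E mult.commute)
  show "inner (x + y) z = inner x z + inner y z"
    by (simp add: E sum.distrib algebra_simps)
  show "inner (r *\<^sub>R x) y = r * inner x y"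
    by (simp add: E sum_distrib_left mult.assoc)
  show "0 \<le> inner x x"
    by (simp add: inner_fseq_def sum_nonneg)
  show "inner x x = 0 \<longleftrightarrow> x = 0"
  proof
    assume "inner x x = 0"
    then have "\<forall>i\<in>{i. coord x i \<noteq> 0}. coord x i * coord x i = 0"
      unfolding inner_fseq_def by (subst (asm) sum_nonneg_eq_0_iff) auto
    then show "x = 0"
      by (intro fseq_eqI) auto
  qed (simp add: inner_fseq_def)
qed (simp_all add: norm_fseq_def dist_fseq_def sgn_fseq_def uniformity_fseq_def open_fseq_def)

end

text \<open>On \<open>Rn n\<close> this is the usual Euclidean structure:\<close>

lemma inner_Rn: "x \<in> Rn n \<Longrightarrow> inner x y = (\<Sum>i<n. coord x i * coord y i)"
  by (rule inner_fseq_superset) (auto simp: Rn_def not_less[symmetric])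

lemma norm_Rn: "x \<in> Rn n \<Longrightarrow> norm x = sqrt (\<Sum>i<n. (coord x i)\<^sup>2)"
  by (simp add: norm_fseq_def inner_Rn power2_eq_square)

definition borel_Rn :: "nat \<Rightarrow> fseq measure" where
  "borel_Rn n = restrict_space borel (Rn n)"

text \<open>
  \<open>D\<close> is the gradient at \<open>x\<close> of a real function on \<open>\<real>\<^sup>n\<close>: the values of \<open>h\<close> outside \<open>Rn n\<close> are
  irrelevant, and since \<open>Rn n\<close> is a subspace, \<open>D \<in> Rn n\<close> is determined by \<open>h\<close> and \<open>x\<close>.
\<close>

definition has_gradient :: "nat \<Rightarrow> (fseq \<Rightarrow> real) \<Rightarrow> fseq \<Rightarrow> fseq \<Rightarrow> bool" where
  "has_gradient n h x D \<longleftrightarrow>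
     D \<in> Rn n \<and> (h has_derivative (\<lambda>v. inner v D)) (at x within Rn n)"

text \<open>As in \<^const>\<open>convex_on\<close>, the domain of a (strongly) convex function is required to be convex.\<close>

definition strongly_convex_on :: "real \<Rightarrow> 'a::real_normed_vector set \<Rightarrow> ('a \<Rightarrow> real) \<Rightarrow> bool" where
  "strongly_convex_on \<alpha> S F \<longleftrightarrow> convex S \<and>
     (\<forall>x\<in>S. \<forall>y\<in>S. \<forall>t\<in>{0..1}.
        F (t *\<^sub>R x + (1 - t) *\<^sub>R y)
          \<le> t * F x + (1 - t) * F y - \<alpha> / 2 * t * (1 - t) * (norm (x - y))\<^sup>2)"

definition is_unique_arg_min_on :: "('a \<Rightarrow> real) \<Rightarrow> 'a set \<Rightarrow> 'a \<Rightarrow> bool" where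
  "is_unique_arg_min_on F S x \<longleftrightarrow>
     is_arg_min F (\<lambda>y. y \<in> S) x \<and> (\<forall>y. is_arg_min F (\<lambda>y. y \<in> S) y \<longrightarrow> y = x)"

text \<open>
  In the next three definitions \<open>\<eta> i j\<close>, \<open>i, j \<in> {1..N}\<close>, is an array of random vectors on \<open>\<Omega>\<close>
  (with values in \<open>Rn m\<close>).
\<close>

definition F_hat :: "nat \<Rightarrow> (fseq \<Rightarrow> fseq \<Rightarrow> real) \<Rightarrow> (nat \<Rightarrow> nat \<Rightarrow> 'w \<Rightarrow> fseq) \<Rightarrow> 'w \<Rightarrow> fseq \<Rightarrow> real" where
  "F_hat N f \<eta> \<omega> \<theta> = 1 / (real N)\<^sup>2 * (\<Sum>i\<in>{1..N}. \<Sum>j\<in>{1..N}. f \<theta> (\<eta> i j \<omega>))"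

definition F_mean :: "'w measure \<Rightarrow> nat \<Rightarrow> (fseq \<Rightarrow> fseq \<Rightarrow> real) \<Rightarrow> (nat \<Rightarrow> nat \<Rightarrow> 'w \<Rightarrow> fseq) \<Rightarrow> fseq \<Rightarrow> real" where
  "F_mean \<Omega> N f \<eta> \<theta> = (\<integral>\<omega>. F_hat N f \<eta> \<omega> \<theta> \<partial>\<Omega>)"

text \<open>
  Joint independence: every subfamily whose index sets \<open>{i} \<union> {j}\<close> are pairwise disjoint is
  independent. Independence of such vectors merely two at a time would admit no exponential
  concentration: for pairwise independent signs \<open>\<eta>\<^sub>i\<^sub>j\<close>, all can equal \<open>1\<close> simultaneously with
  probability of order \<open>1 / N\<^sup>2\<close>.
\<close>

definition indep_off_shared_index :: "'w measure \<Rightarrow> nat \<Rightarrow> nat \<Rightarrow> (nat \<Rightarrow> nat \<Rightarrow> 'w \<Rightarrow> fseq) \<Rightarrow> bool" where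
  "indep_off_shared_index \<Omega> m N \<eta> \<longleftrightarrow>
     (\<forall>S. S \<subseteq> {1..N} \<times> {1..N} \<longrightarrow>
        pairwise (\<lambda>(i\<^sub>1, j\<^sub>1) (i\<^sub>2, j\<^sub>2). disjnt ({i\<^sub>1} \<union> {j\<^sub>1}) ({i\<^sub>2} \<union> {j\<^sub>2})) S \<longrightarrow>
        prob_space.indep_vars \<Omega> (\<lambda>_. borel_Rn m) (\<lambda>(i, j). \<eta> i j) S)"

end

theory Submission
  imports Defs
begin

text \<open>
  Strong convexity reduces the claim to \<open>sup\<^sub>C \<bar>F_hat - F_mean\<bar> < \<alpha> \<epsilon>\<^sup>2 / 4\<close>. At a single point, the \<open>N\<^sup>2\<close>
  summands are split round-robin by \<open>(i + j) mod N\<close> and by the truth value of \<open>i \<le> j\<close>: within each of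
  these \<open>2 N\<close> blocks, of size at most \<open>N\<close>, the index sets \<open>{i, j}\<close> are pairwise disjoint, so the
  block is independent, and Jensen's inequality for the mean over the blocks bounds the exponential
  moment of the whole sum. This gives a Bernstein-type tail \<open>2 exp (- c t\<^sup>2 N / M)\<close>. Applied to \<open>g\<close>,
  the same moment bound shows that \<open>F_hat\<close> is \<open>2 L\<close>-Lipschitz outside an event of probability
  \<open>exp (- N)\<close>, and a union bound over a net of \<open>C\<close> makes the deviation bound uniform.
\<close>

section \<open>Exponential moments of arrays\<close>

lemma exp_mult_le_quadratic:
  fixes u x :: real
  assumes "\<bar>u\<bar> \<le> 1/2"
  shows "exp (u * x) \<le> 1 + u * x + 4 * u\<^sup>2 * exp \<bar>x\<bar>"
proof -
  obtain t where t: "\<bar>t\<bar> \<le> \<bar>u * x\<bar>"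
    and eq: "exp (u * x) = (\<Sum>m<2. (u * x) ^ m / fact m) + exp t / fact 2 * (u * x) ^ 2"
    using Maclaurin_exp_le[of "u * x" 2] by blast
  \<comment> \<open>Because \<bar>u\<bar> is at most 1/2, the Lagrange remainder uses up only half
    of the exponent in \<open>exp \<bar>x\<bar>\<close>. The other half absorbs
    \<open>x\<^sup>2\<close> at the price of a factor 8, and the 1/2! of the Taylor term turns 8
    into 4.\<close>
  have "\<bar>u * x\<bar> \<le> \<bar>x\<bar> / 2"
    using mult_right_mono[OF assms, of "\<bar>x\<bar>"] by (simp add: abs_mult)
  then have "exp t \<le> exp (\<bar>x\<bar> / 2)"
    using t by simp
  moreover have "x\<^sup>2 \<le> 8 * exp (\<bar>x\<bar> / 2)"
    using exp_lower_Taylor_quadratic[of "\<bar>x\<bar> / 2"] by (simp add: power2_eq_square)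
  ultimately have "exp t * x\<^sup>2 \<le> exp (\<bar>x\<bar> / 2) * (8 * exp (\<bar>x\<bar> / 2))"
    by (intro mult_mono) auto
  also have "\<dots> = 8 * exp \<bar>x\<bar>"
    by (simp flip: exp_add)
  finally have "u\<^sup>2 * (exp t * x\<^sup>2) \<le> u\<^sup>2 * (8 * exp \<bar>x\<bar>)"
    by (intro mult_left_mono) auto
  then show ?thesis
    unfolding eq by (simp add: numeral_2_eq_2 power_mult_distrib mult_ac)
qed

text \<open>Centering removes the linear term of the quadratic bound, so the exponent is of order
  \<open>u\<^sup>2\<close>, as for a subgaussian variable, but only for small u. The two-sided
  exponential moment takes the place of a variance.\<close>

lemma (in prob_space) centered_mgf_le:
  fixes X :: "'a \<Rightarrow> real"
  assumes X: "integrable M X" "expectation X = 0"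
    and E: "integrable M (\<lambda>\<omega>. exp \<bar>X \<omega>\<bar>)" "expectation (\<lambda>\<omega>. exp \<bar>X \<omega>\<bar>) \<le> B"
    and u: "\<bar>u\<bar> \<le> 1/2"
  shows "integrable M (\<lambda>\<omega>. exp (u * X \<omega>))"
    and "expectation (\<lambda>\<omega>. exp (u * X \<omega>)) \<le> exp (4 * u\<^sup>2 * B)"
proof -
  have [measurable]: "X \<in> borel_measurable M"
    using X by auto
  have le: "u * x \<le> \<bar>x\<bar>" for x :: real
    using mult_right_mono[of "\<bar>u\<bar>" 1 "\<bar>x\<bar>"] u by (simp flip: abs_mult)
  show int: "integrable M (\<lambda>\<omega>. exp (u * X \<omega>))"
    by (rule Bochner_Integration.integrable_bound[OF E(1)]) (use le in auto)
  have "expectation (\<lambda>\<omega>. exp (u * X \<omega>)) \<le> expectation (\<lambda>\<omega>. 1 + u * X \<omega> + 4 * u\<^sup>2 * exp \<bar>X \<omega>\<bar>)"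
    by (intro integral_mono int exp_mult_le_quadratic u) (use X E in auto)
  also have "\<dots> = 1 + 4 * u\<^sup>2 * expectation (\<lambda>\<omega>. exp \<bar>X \<omega>\<bar>)"
    using X E by (simp add: prob_space)
  also have "\<dots> \<le> 1 + 4 * u\<^sup>2 * B"
    using E(2) by (intro add_left_mono mult_left_mono) auto
  also have "\<dots> \<le> exp (4 * u\<^sup>2 * B)"
    by (rule exp_ge_add_one_self)
  finally show "expectation (\<lambda>\<omega>. exp (u * X \<omega>)) \<le> exp (4 * u\<^sup>2 * B)" .
qed

section \<open>Round-robin partition of the index square\<close>

definition block_index :: "nat \<Rightarrow> nat \<times> nat \<Rightarrow> nat \<times> bool" where
  "block_index N = (\<lambda>(i, j). ((i + j) mod N, i \<le> j))"

definition block :: "nat \<Rightarrow> nat \<times> bool \<Rightarrow> (nat \<times> nat) set" where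
  "block N c = {p \<in> {1..N} \<times> {1..N}. block_index N p = c}"

lemma finite_block [simp]: "finite (block N c)"
  by (simp add: block_def)

lemma add_mod_cancel:
  fixes N :: nat
  assumes "(i + j) mod N = (i + j') mod N" "j \<in> {1..N}" "j' \<in> {1..N}"
  shows "j = j'"
proof -
  have "j = j'" if "j \<le> j'" "(i + j) mod N = (i + j') mod N" "j \<in> {1..N}" "j' \<in> {1..N}" for j j'
  proof -
    have "N dvd j' - j"
      using that mod_eq_dvd_iff_nat[of "i + j" "i + j'" N] by simp
    moreover have "j' - j < N"
      using that by auto
    ultimately show ?thesis
      using that(1) by (auto dest: nat_dvd_not_less)
  qed
  from this[of j j'] this[of j' j] assms show ?thesis
    by (metis nat_le_linear)
qed

lemma card_block_le: "card (block N c) \<le> N"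
proof -
  have "p = q" if "p \<in> block N c" "q \<in> block N c" "fst p = fst q" for p q
    using that add_mod_cancel[of "fst p" "snd p" N "snd q"]
    by (auto simp: block_def block_index_def prod_eq_iff case_prod_beta)
  then have "inj_on fst (block N c)"
    by (auto intro: inj_onI)
  then have "card (block N c) \<le> card {1..N}"
    by (rule card_inj_on_le) (auto simp: block_def)
  then show ?thesis by simp
qed

text \<open>Since {1..N} represents every residue exactly once, a common entry, together with the
  common sum mod N, determines the other entry. A coincidence in the same position thus makes the
  pairs equal. A crossed coincidence makes them mirror images (i, j) and (j, i), and then equality
  of the flags \<open>i \<le> j\<close> and \<open>j \<le> i\<close> forces i = j.\<close>

lemma pairwise_disjnt_block:
  "pairwise (\<lambda>(i\<^sub>1, j\<^sub>1) (i\<^sub>2, j\<^sub>2). disjnt ({i\<^sub>1} \<union> {j\<^sub>1}) ({i\<^sub>2} \<union> {j\<^sub>2})) (block N c)"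
proof (rule pairwiseI)
  fix p q
  assume b: "p \<in> block N c" "q \<in> block N c" and "p \<noteq> q"
  obtain i j i' j' where pq: "p = (i, j)" "q = (i', j')"
    by (metis surj_pair)
  from \<open>p \<noteq> q\<close> have ne: "\<not> (i = i' \<and> j = j')"
    by (simp add: pq)
  from b have r: "i \<in> {1..N}" "j \<in> {1..N}" "i' \<in> {1..N}" "j' \<in> {1..N}"
    and m: "(i + j) mod N = (i' + j') mod N" and o: "(i \<le> j) = (i' \<le> j')"
    by (auto simp: pq block_def block_index_def)
  have "i \<noteq> i'"
    using add_mod_cancel[of i j N j'] r m ne by auto
  moreover have "j \<noteq> j'"
    using add_mod_cancel[of j i N i'] r m ne by (auto simp: add.commute)
  moreover have "i \<noteq> j'"
    using add_mod_cancel[of i j N i'] r m o ne by (auto simp: add.commute)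
  moreover have "j \<noteq> i'"
    using add_mod_cancel[of j i N j'] r m o ne by (auto simp: add.commute)
  ultimately show "(case p of (i\<^sub>1, j\<^sub>1) \<Rightarrow> \<lambda>(i\<^sub>2, j\<^sub>2). disjnt ({i\<^sub>1} \<union> {j\<^sub>1}) ({i\<^sub>2} \<union> {j\<^sub>2})) q"
    by (auto simp: pq disjnt_def)
qed

lemma sum_blocks:
  fixes h :: "nat \<times> nat \<Rightarrow> real"
  assumes "N \<ge> 1"
  shows "(\<Sum>c\<in>{..<N} \<times> UNIV. sum h (block N c)) = (\<Sum>i\<in>{1..N}. \<Sum>j\<in>{1..N}. h (i, j))"
proof -
  have "(\<Sum>c\<in>{..<N} \<times> UNIV. sum h (block N c)) = sum h ({1..N} \<times> {1..N})"
    unfolding block_def using assms by (intro sum.group) (auto simp: block_index_def)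
  then show ?thesis
    by (simp add: sum.cartesian_product)
qed

section \<open>Exponential tails of double sums\<close>

lemma exp_mean_le_mean_exp:
  fixes a :: "'c \<Rightarrow> real"
  assumes "finite T" "T \<noteq> {}"
  shows "exp ((\<Sum>c\<in>T. a c) / card T) \<le> (\<Sum>c\<in>T. exp (a c)) / card T"
proof -
  have "exp (\<Sum>c\<in>T. (1 / card T) *\<^sub>R a c) \<le> (\<Sum>c\<in>T. (1 / card T) * exp (a c))"
    using assms by (intro convex_on_sum[OF _ _ exp_convex]) auto
  then show ?thesis
    by (simp flip: sum_distrib_left sum_divide_distrib)
qed

text \<open>Disjointness of the index sets makes the members of one block jointly independent, so
  the expectation of the exponential factors. The bound \<open>B ^ N\<close> is the same for all
  blocks, whatever their size.\<close>

lemma block_mgf: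
  fixes h :: "nat \<Rightarrow> nat \<Rightarrow> fseq \<Rightarrow> real"
  assumes "prob_space \<Omega>" and ind: "indep_off_shared_index \<Omega> m N \<eta>"
    and h: "\<And>i j. i \<in> {1..N} \<Longrightarrow> j \<in> {1..N} \<Longrightarrow> h i j \<in> borel_measurable (borel_Rn m)"
    and int: "\<And>i j. i \<in> {1..N} \<Longrightarrow> j \<in> {1..N} \<Longrightarrow> integrable \<Omega> (\<lambda>\<omega>. exp (h i j (\<eta> i j \<omega>)))"
    and B: "\<And>i j. i \<in> {1..N} \<Longrightarrow> j \<in> {1..N} \<Longrightarrow> (\<integral>\<omega>. exp (h i j (\<eta> i j \<omega>)) \<partial>\<Omega>) \<le> B" "1 \<le> B"
  shows "integrable \<Omega> (\<lambda>\<omega>. exp (\<Sum>(i, j)\<in>block N c. h i j (\<eta> i j \<omega>)))"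
    and "(\<integral>\<omega>. exp (\<Sum>(i, j)\<in>block N c. h i j (\<eta> i j \<omega>)) \<partial>\<Omega>) \<le> B ^ N"
proof -
  interpret prob_space \<Omega> by fact
  let ?S = "block N c"
  define X where "X = (\<lambda>(i, j) \<omega>. exp (h i j (\<eta> i j \<omega>)))"
  have sub: "?S \<subseteq> {1..N} \<times> {1..N}"
    by (auto simp: block_def)
  have "indep_vars (\<lambda>_. borel_Rn m) (\<lambda>(i, j). \<eta> i j) ?S"
    using ind sub pairwise_disjnt_block unfolding indep_off_shared_index_def by blast
  then have "indep_vars (\<lambda>_. borel) (\<lambda>p \<omega>. (\<lambda>(i, j) y. exp (h i j y)) p ((\<lambda>(i, j). \<eta> i j) p \<omega>)) ?S"
    by (rule indep_vars_compose2) (use h sub in auto)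
  then have X: "indep_vars (\<lambda>_. borel) X ?S"
    by (simp add: X_def case_prod_beta')
  have iX: "integrable \<Omega> (X p)" if "p \<in> ?S" for p
    using int sub that by (auto simp: X_def)
  have eq: "exp (\<Sum>(i, j)\<in>?S. h i j (\<eta> i j \<omega>)) = (\<Prod>p\<in>?S. X p \<omega>)" for \<omega>
    by (simp add: exp_sum X_def case_prod_beta)
  show "integrable \<Omega> (\<lambda>\<omega>. exp (\<Sum>(i, j)\<in>?S. h i j (\<eta> i j \<omega>)))"
    unfolding eq by (rule indep_vars_integrable[OF _ X iX]) auto
  have "(\<integral>\<omega>. exp (\<Sum>(i, j)\<in>?S. h i j (\<eta> i j \<omega>)) \<partial>\<Omega>) = (\<Prod>p\<in>?S. expectation (X p))"
    unfolding eq by (rule indep_vars_lebesgue_integral[OF _ X iX]) auto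
  also have "\<dots> \<le> (\<Prod>p\<in>?S. B)"
    using B sub by (intro prod_mono) (auto simp: X_def)
  \<comment> \<open>A block may have fewer than N members; \<open>1 \<le> B\<close> pays for the
    missing factors.\<close>
  also have "\<dots> \<le> B ^ N"
    using power_increasing[OF card_block_le B(2)] by simp
  finally show "(\<integral>\<omega>. exp (\<Sum>(i, j)\<in>?S. h i j (\<eta> i j \<omega>)) \<partial>\<Omega>) \<le> B ^ N" .
qed

text \<open>This is a Chernoff bound with exponential parameter 1/(2N) for the double sum, where 2N
  is the number of blocks. Scaling the threshold \<open>a * N\<^sup>2\<close> by 1/(2N) gives the
  exponent \<open>a * N / 2\<close>.\<close>

lemma array_tail:
  fixes h :: "nat \<Rightarrow> nat \<Rightarrow> fseq \<Rightarrow> real"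
  assumes "prob_space \<Omega>" and ind: "indep_off_shared_index \<Omega> m N \<eta>" and N: "N \<ge> 1"
    and \<eta>: "\<And>i j. i \<in> {1..N} \<Longrightarrow> j \<in> {1..N} \<Longrightarrow> \<eta> i j \<in> measurable \<Omega> (borel_Rn m)"
    and h: "\<And>i j. i \<in> {1..N} \<Longrightarrow> j \<in> {1..N} \<Longrightarrow> h i j \<in> borel_measurable (borel_Rn m)"
    and int: "\<And>i j. i \<in> {1..N} \<Longrightarrow> j \<in> {1..N} \<Longrightarrow> integrable \<Omega> (\<lambda>\<omega>. exp (h i j (\<eta> i j \<omega>)))"
    and B: "\<And>i j. i \<in> {1..N} \<Longrightarrow> j \<in> {1..N} \<Longrightarrow> (\<integral>\<omega>. exp (h i j (\<eta> i j \<omega>)) \<partial>\<Omega>) \<le> B" "1 \<le> B"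
  shows "measure \<Omega> {\<omega> \<in> space \<Omega>. a \<le> (\<Sum>i\<in>{1..N}. \<Sum>j\<in>{1..N}. h i j (\<eta> i j \<omega>)) / (real N)\<^sup>2}
    \<le> B ^ N * exp (- (a * real N / 2))"
proof -
  interpret prob_space \<Omega> by fact
  have [measurable]: "(\<lambda>\<omega>. h i j (\<eta> i j \<omega>)) \<in> borel_measurable \<Omega>"
    if "i \<in> {1..N}" "j \<in> {1..N}" for i j
    using measurable_compose[OF \<eta> h] that by blast
  define T :: "(nat \<times> bool) set" where "T = {..<N} \<times> UNIV"
  define Z where "Z \<omega> = (\<Sum>i\<in>{1..N}. \<Sum>j\<in>{1..N}. h i j (\<eta> i j \<omega>))" for \<omega>
  define Y where "Y c \<omega> = (\<Sum>(i, j)\<in>block N c. h i j (\<eta> i j \<omega>))" for c \<omega>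
  have T: "finite T" "T \<noteq> {}" "card T = 2 * N"
    using N by (auto simp: T_def card_cartesian_product lessThan_empty_iff)
  have Z: "Z \<omega> = (\<Sum>c\<in>T. Y c \<omega>)" for \<omega>
    using sum_blocks[OF N, of "\<lambda>(i, j). h i j (\<eta> i j \<omega>)"]
    by (simp add: Z_def Y_def T_def)
  have [measurable]: "Z \<in> borel_measurable \<Omega>"
    unfolding Z_def by (intro borel_measurable_sum) measurable
  have Y: "integrable \<Omega> (\<lambda>\<omega>. exp (Y c \<omega>))" "expectation (\<lambda>\<omega>. exp (Y c \<omega>)) \<le> B ^ N" for c
    unfolding Y_def using block_mgf[OF assms(1) ind h int B] by auto
  \<comment> \<open>Different blocks may depend on each other. Jensen's inequality replaces the
    product over blocks by an average, whose expectation is linear and so calls for no joint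
    independence.\<close>
  have le: "exp (Z \<omega> / (2 * N)) \<le> (\<Sum>c\<in>T. exp (Y c \<omega>)) / (2 * N)" for \<omega>
    using exp_mean_le_mean_exp[OF T(1,2), of "\<lambda>c. Y c \<omega>"] by (simp add: Z T(3))
  have iS: "integrable \<Omega> (\<lambda>\<omega>. (\<Sum>c\<in>T. exp (Y c \<omega>)) / (2 * N))"
    using Y by auto
  have iZ: "integrable \<Omega> (\<lambda>\<omega>. exp (Z \<omega> / (2 * N)))"
    by (rule Bochner_Integration.integrable_bound[OF iS])
       (use le in \<open>auto simp: sum_nonneg intro!: AE_I2 order_trans[OF le]\<close>)
  have "expectation (\<lambda>\<omega>. exp (Z \<omega> / (2 * N))) \<le> expectation (\<lambda>\<omega>. (\<Sum>c\<in>T. exp (Y c \<omega>)) / (2 * N))"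
    by (intro integral_mono iZ iS le)
  also have "\<dots> = (\<Sum>c\<in>T. expectation (\<lambda>\<omega>. exp (Y c \<omega>))) / (2 * N)"
    using Y by (subst integral_divide_zero) (simp add: Bochner_Integration.integral_sum)
  also have "\<dots> \<le> (\<Sum>c\<in>T. B ^ N) / (2 * N)"
    by (intro divide_right_mono sum_mono Y) auto
  also have "\<dots> = B ^ N"
    using N by (simp add: T(3))
  finally have EZ: "expectation (\<lambda>\<omega>. exp (Z \<omega> / (2 * N))) \<le> B ^ N" .
  have iff: "a \<le> Z \<omega> / (real N)\<^sup>2 \<longleftrightarrow> exp (a * N / 2) \<le> exp (Z \<omega> / (2 * N))" for \<omega>
    using N by (simp add: field_simps power2_eq_square)
  have "prob {\<omega> \<in> space \<Omega>. exp (a * N / 2) \<le> exp (Z \<omega> / (2 * N))}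
      \<le> expectation (\<lambda>\<omega>. exp (Z \<omega> / (2 * N))) / exp (a * N / 2)"
    by (intro integral_Markov_inequality_measure[OF iZ, where A="{}"]) auto
  also have "\<dots> \<le> B ^ N / exp (a * N / 2)"
    by (intro divide_right_mono EZ) auto
  also have "\<dots> = B ^ N * exp (- (a * N / 2))"
    by (simp only: exp_minus divide_inverse)
  finally show ?thesis
    unfolding Z_def[symmetric] iff .
qed

section \<open>Averages over the index square\<close>

definition array_mean :: "nat \<Rightarrow> (nat \<Rightarrow> nat \<Rightarrow> real) \<Rightarrow> real" where
  "array_mean N a = (\<Sum>i\<in>{1..N}. \<Sum>j\<in>{1..N}. a i j) / (real N)\<^sup>2"

lemma F_hat_eq: "F_hat N f \<eta> \<omega> \<theta> = array_mean N (\<lambda>i j. f \<theta> (\<eta> i j \<omega>))"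
  by (simp add: F_hat_def array_mean_def)

lemma array_mean_mono:
  assumes "\<And>i j. i \<in> {1..N} \<Longrightarrow> j \<in> {1..N} \<Longrightarrow> a i j \<le> b i j"
  shows "array_mean N a \<le> array_mean N b"
  unfolding array_mean_def by (intro divide_right_mono sum_mono assms) auto

lemma array_mean_const [simp]: "N \<ge> 1 \<Longrightarrow> array_mean N (\<lambda>_ _. c) = c"
  by (simp add: array_mean_def power2_eq_square)

lemma array_mean_diff: "array_mean N (\<lambda>i j. a i j - b i j) = array_mean N a - array_mean N b"
  by (simp add: array_mean_def sum_subtractf diff_divide_distrib)

lemma array_mean_mult_left: "array_mean N (\<lambda>i j. c * a i j) = c * array_mean N a"
  by (simp add: array_mean_def sum_distrib_left)

lemma array_mean_mult_right: "array_mean N (\<lambda>i j. a i j * c) = array_mean N a * c"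
  by (simp add: array_mean_def sum_distrib_right)

lemma array_mean_abs_le:
  assumes "\<And>i j. i \<in> {1..N} \<Longrightarrow> j \<in> {1..N} \<Longrightarrow> \<bar>a i j - b i j\<bar> \<le> c i j"
  shows "\<bar>array_mean N a - array_mean N b\<bar> \<le> array_mean N c"
proof -
  have "array_mean N (\<lambda>i j. a i j - b i j) \<le> array_mean N c"
    using assms by (intro array_mean_mono) (simp add: abs_le_iff)
  moreover have "array_mean N (\<lambda>i j. b i j - a i j) \<le> array_mean N c"
    using assms by (intro array_mean_mono) (simp add: abs_le_iff)
  ultimately show ?thesis
    by (simp add: array_mean_diff)
qed

lemma borel_measurable_array_mean:
  assumes "\<And>i j. i \<in> {1..N} \<Longrightarrow> j \<in> {1..N} \<Longrightarrow> X i j \<in> borel_measurable \<Omega>"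
  shows "(\<lambda>\<omega>. array_mean N (\<lambda>i j. X i j \<omega>)) \<in> borel_measurable \<Omega>"
  unfolding array_mean_def using assms
  by (intro borel_measurable_divide borel_measurable_sum borel_measurable_const) blast

lemma integral_array_mean:
  assumes "\<And>i j. i \<in> {1..N} \<Longrightarrow> j \<in> {1..N} \<Longrightarrow> integrable \<Omega> (X i j)"
  shows "(\<integral>\<omega>. array_mean N (\<lambda>i j. X i j \<omega>) \<partial>\<Omega>) = array_mean N (\<lambda>i j. \<integral>\<omega>. X i j \<omega> \<partial>\<Omega>)"
proof -
  have "(\<integral>\<omega>. (\<Sum>i\<in>{1..N}. \<Sum>j\<in>{1..N}. X i j \<omega>) \<partial>\<Omega>)
      = (\<Sum>i\<in>{1..N}. \<Sum>j\<in>{1..N}. \<integral>\<omega>. X i j \<omega> \<partial>\<Omega>)"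
    by (subst Bochner_Integration.integral_sum, blast intro: assms Bochner_Integration.integrable_sum)
       (intro sum.cong refl Bochner_Integration.integral_sum assms)
  then show ?thesis
    unfolding array_mean_def by (subst integral_divide_zero) simp
qed

section \<open>Deviation of averages\<close>

lemma array_deviation_tail_signed:
  fixes h :: "nat \<Rightarrow> nat \<Rightarrow> fseq \<Rightarrow> real"
  assumes "prob_space \<Omega>" and ind: "indep_off_shared_index \<Omega> m N \<eta>" and N: "N \<ge> 1"
    and \<eta>: "\<And>i j. i \<in> {1..N} \<Longrightarrow> j \<in> {1..N} \<Longrightarrow> \<eta> i j \<in> measurable \<Omega> (borel_Rn m)"
    and h: "\<And>i j. i \<in> {1..N} \<Longrightarrow> j \<in> {1..N} \<Longrightarrow> h i j \<in> borel_measurable (borel_Rn m)"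
    and int: "\<And>i j. i \<in> {1..N} \<Longrightarrow> j \<in> {1..N} \<Longrightarrow> integrable \<Omega> (\<lambda>\<omega>. h i j (\<eta> i j \<omega>))"
    and \<mu>: "\<And>i j. i \<in> {1..N} \<Longrightarrow> j \<in> {1..N} \<Longrightarrow> (\<integral>\<omega>. h i j (\<eta> i j \<omega>) \<partial>\<Omega>) = \<mu> i j"
    and exp_int: "\<And>i j. i \<in> {1..N} \<Longrightarrow> j \<in> {1..N} \<Longrightarrow> integrable \<Omega> (\<lambda>\<omega>. exp \<bar>h i j (\<eta> i j \<omega>) - \<mu> i j\<bar>)"
    and B: "\<And>i j. i \<in> {1..N} \<Longrightarrow> j \<in> {1..N} \<Longrightarrow> (\<integral>\<omega>. exp \<bar>h i j (\<eta> i j \<omega>) - \<mu> i j\<bar> \<partial>\<Omega>) \<le> B" "1 \<le> B"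
    and t: "0 < t" "t \<le> 1" and s: "\<bar>s\<bar> = 1"
  shows "measure \<Omega> {\<omega> \<in> space \<Omega>. t \<le> s * (array_mean N (\<lambda>i j. h i j (\<eta> i j \<omega>)) - array_mean N \<mu>)}
    \<le> exp (- (t\<^sup>2 * real N / (64 * B)))"
proof -
  interpret prob_space \<Omega> by fact
  \<comment> \<open>This v minimizes the exponent
    \<open>N * (4 * v\<^sup>2 * B - v * t / 2)\<close>, whose minimum is
    \<open>- t\<^sup>2 * N / (64 * B)\<close>. The bounds t \<le> 1 \<le> B keep v in the range
    where the quadratic moment bound holds. The sign s selects the upper or the lower tail.\<close>
  define v where "v = t / (16 * B)"
  define u where "u = v * s"
  have v: "v > 0" "v \<le> 1/2"
    using t B(2) by (auto simp: v_def field_simps)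
  have s2: "s\<^sup>2 = 1"
    using s by (metis one_power2 power2_abs)
  have u: "\<bar>u\<bar> \<le> 1/2" "u\<^sup>2 = v\<^sup>2"
    using v s s2 by (auto simp: u_def abs_mult power_mult_distrib)
  have mgf: "integrable \<Omega> (\<lambda>\<omega>. exp (u * (h i j (\<eta> i j \<omega>) - \<mu> i j)))"
      "expectation (\<lambda>\<omega>. exp (u * (h i j (\<eta> i j \<omega>) - \<mu> i j))) \<le> exp (4 * u\<^sup>2 * B)"
    if "i \<in> {1..N}" "j \<in> {1..N}" for i j
    using that int \<mu> by (auto intro!: centered_mgf_le exp_int B(1) u(1) simp: prob_space)
  have "t \<le> s * d \<longleftrightarrow> v * t \<le> u * d" for d
    using v by (simp add: u_def mult.assoc)
  then have "prob {\<omega> \<in> space \<Omega>. t \<le> s * (array_mean N (\<lambda>i j. h i j (\<eta> i j \<omega>)) - array_mean N \<mu>)}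
      = prob {\<omega> \<in> space \<Omega>. v * t \<le> (\<Sum>i\<in>{1..N}. \<Sum>j\<in>{1..N}. u * (h i j (\<eta> i j \<omega>) - \<mu> i j)) / (real N)\<^sup>2}"
    unfolding array_mean_def[symmetric] array_mean_mult_left array_mean_diff by simp
  also have "\<dots> \<le> exp (4 * u\<^sup>2 * B) ^ N * exp (- (v * t * real N / 2))"
    using B(2) by (intro array_tail[OF assms(1) ind N \<eta>] mgf borel_measurable_times borel_measurable_diff
          borel_measurable_const h) auto
  also have "\<dots> = exp (real N * (4 * u\<^sup>2 * B) + - (v * t * real N / 2))"
    by (simp only: exp_add exp_of_nat_mult)
  also have "real N * (4 * u\<^sup>2 * B) + - (v * t * real N / 2) = - (v * t * real N / 4)"
  proof -
    have "u\<^sup>2 * B = v * (v * B)"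
      by (subst u(2)) (simp only: power2_eq_square mult.assoc)
    also have "v * B = t / 16"
      using B(2) by (simp add: v_def)
    finally have uB: "u\<^sup>2 * B = v * (t / 16)" .
    show ?thesis
      by (simp only: mult.assoc uB) simp
  qed
  also have "v * t * real N / 4 = t\<^sup>2 * real N / (64 * B)"
    by (simp add: v_def power2_eq_square)
  finally show ?thesis .
qed

lemma array_deviation_tail:
  fixes h :: "nat \<Rightarrow> nat \<Rightarrow> fseq \<Rightarrow> real"
  assumes "prob_space \<Omega>" and ind: "indep_off_shared_index \<Omega> m N \<eta>" and N: "N \<ge> 1"
    and \<eta>: "\<And>i j. i \<in> {1..N} \<Longrightarrow> j \<in> {1..N} \<Longrightarrow> \<eta> i j \<in> measurable \<Omega> (borel_Rn m)"
    and h: "\<And>i j. i \<in> {1..N} \<Longrightarrow> j \<in> {1..N} \<Longrightarrow> h i j \<in> borel_measurable (borel_Rn m)"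
    and int: "\<And>i j. i \<in> {1..N} \<Longrightarrow> j \<in> {1..N} \<Longrightarrow> integrable \<Omega> (\<lambda>\<omega>. h i j (\<eta> i j \<omega>))"
    and \<mu>: "\<And>i j. i \<in> {1..N} \<Longrightarrow> j \<in> {1..N} \<Longrightarrow> (\<integral>\<omega>. h i j (\<eta> i j \<omega>) \<partial>\<Omega>) = \<mu> i j"
    and exp_int: "\<And>i j. i \<in> {1..N} \<Longrightarrow> j \<in> {1..N} \<Longrightarrow> integrable \<Omega> (\<lambda>\<omega>. exp \<bar>h i j (\<eta> i j \<omega>) - \<mu> i j\<bar>)"
    and B: "\<And>i j. i \<in> {1..N} \<Longrightarrow> j \<in> {1..N} \<Longrightarrow> (\<integral>\<omega>. exp \<bar>h i j (\<eta> i j \<omega>) - \<mu> i j\<bar> \<partial>\<Omega>) \<le> B" "1 \<le> B"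
    and t: "0 < t" "t \<le> 1"
  shows "measure \<Omega> {\<omega> \<in> space \<Omega>. t \<le> \<bar>array_mean N (\<lambda>i j. h i j (\<eta> i j \<omega>)) - array_mean N \<mu>\<bar>}
    \<le> 2 * exp (- (t\<^sup>2 * real N / (64 * B)))"
proof -
  interpret prob_space \<Omega> by fact
  define d where "d \<omega> = array_mean N (\<lambda>i j. h i j (\<eta> i j \<omega>)) - array_mean N \<mu>" for \<omega>
  have [measurable]: "d \<in> borel_measurable \<Omega>"
    unfolding d_def
    by (intro borel_measurable_diff borel_measurable_const borel_measurable_array_mean
          measurable_compose[OF \<eta> h])
  have tail: "prob {\<omega> \<in> space \<Omega>. t \<le> s * d \<omega>} \<le> exp (- (t\<^sup>2 * real N / (64 * B)))"
    if "\<bar>s\<bar> = 1" for s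
    unfolding d_def by (rule array_deviation_tail_signed[OF assms that])
  have "{\<omega> \<in> space \<Omega>. t \<le> \<bar>d \<omega>\<bar>} = {\<omega> \<in> space \<Omega>. t \<le> 1 * d \<omega>} \<union> {\<omega> \<in> space \<Omega>. t \<le> -1 * d \<omega>}"
    by (auto simp: abs_real_def)
  also have "prob \<dots> \<le> prob {\<omega> \<in> space \<Omega>. t \<le> 1 * d \<omega>} + prob {\<omega> \<in> space \<Omega>. t \<le> -1 * d \<omega>}"
    by (rule measure_Un_le) measurable
  also have "\<dots> \<le> exp (- (t\<^sup>2 * real N / (64 * B))) + exp (- (t\<^sup>2 * real N / (64 * B)))"
    by (intro add_mono tail) auto
  finally show ?thesis
    by (simp add: d_def)
qed

text \<open>At the level 2L the Chernoff bound is \<open>(L * exp (- L)) ^ N\<close>, and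
  \<open>L \<le> exp (L - 1)\<close> leaves exp(-N). Applied to g, this controls the random
  Lipschitz constant of the empirical objective.\<close>

lemma array_mean_exceeds_tail:
  fixes h :: "nat \<Rightarrow> nat \<Rightarrow> fseq \<Rightarrow> real"
  assumes "prob_space \<Omega>" and ind: "indep_off_shared_index \<Omega> m N \<eta>" and N: "N \<ge> 1"
    and \<eta>: "\<And>i j. i \<in> {1..N} \<Longrightarrow> j \<in> {1..N} \<Longrightarrow> \<eta> i j \<in> measurable \<Omega> (borel_Rn m)"
    and h: "\<And>i j. i \<in> {1..N} \<Longrightarrow> j \<in> {1..N} \<Longrightarrow> h i j \<in> borel_measurable (borel_Rn m)"
    and int: "\<And>i j. i \<in> {1..N} \<Longrightarrow> j \<in> {1..N} \<Longrightarrow> integrable \<Omega> (\<lambda>\<omega>. exp (h i j (\<eta> i j \<omega>)))"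
    and L: "\<And>i j. i \<in> {1..N} \<Longrightarrow> j \<in> {1..N} \<Longrightarrow> (\<integral>\<omega>. exp (h i j (\<eta> i j \<omega>)) \<partial>\<Omega>) \<le> L" "1 \<le> L"
  shows "measure \<Omega> {\<omega> \<in> space \<Omega>. 2 * L \<le> array_mean N (\<lambda>i j. h i j (\<eta> i j \<omega>))} \<le> exp (- real N)"
proof -
  have "measure \<Omega> {\<omega> \<in> space \<Omega>. 2 * L \<le> array_mean N (\<lambda>i j. h i j (\<eta> i j \<omega>))}
      \<le> L ^ N * exp (- (2 * L * real N / 2))"
    unfolding array_mean_def by (rule array_tail[OF assms])
  also have "\<dots> \<le> exp (L - 1) ^ N * exp (- (2 * L * real N / 2))"
    using L(2) exp_ge_add_one_self[of "L - 1"] by (intro mult_right_mono power_mono) auto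
  also have "\<dots> = exp (real N * (L - 1) + - (2 * L * real N / 2))"
    by (simp only: exp_add exp_of_nat_mult)
  also have "real N * (L - 1) + - (2 * L * real N / 2) = - real N"
    by (simp add: algebra_simps)
  finally show ?thesis .
qed

section \<open>Convexity and nets\<close>

text \<open>A derivative within \<open>Rn k\<close> is also one within C, Cauchy-Schwarz bounds its
  operator norm by the norm of the gradient, and convexity of C allows the mean value inequality
  along the segment from x to y.\<close>

lemma lipschitz_of_has_gradient:
  assumes C: "convex C" "C \<subseteq> Rn k"
    and D: "\<And>x. x \<in> C \<Longrightarrow> \<exists>D. has_gradient k h x D \<and> norm D \<le> B"
    and xy: "x \<in> C" "y \<in> C"
  shows "\<bar>h x - h y\<bar> \<le> B * norm (x - y)"
proof -
  from D obtain D where D: "\<And>x. x \<in> C \<Longrightarrow> has_gradient k h x (D x)" "\<And>x. x \<in> C \<Longrightarrow> norm (D x) \<le> B"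
    by metis
  have "norm (h x - h y) \<le> B * norm (x - y)"
  proof (rule differentiable_bound[OF C(1) _ _ xy(1,2)])
    fix z assume z: "z \<in> C"
    show "(h has_derivative (\<lambda>v. inner v (D z))) (at z within C)"
      using D(1)[OF z] C(2) unfolding has_gradient_def by (blast intro: has_derivative_subset)
    show "onorm (\<lambda>v. inner v (D z)) \<le> B"
    proof (rule onorm_bound)
      fix v
      have "norm (inner v (D z)) \<le> norm v * norm (D z)"
        by (simp add: Cauchy_Schwarz_ineq2)
      also have "\<dots> \<le> norm v * B"
        by (intro mult_left_mono D z) auto
      finally show "norm (inner v (D z)) \<le> B * norm v"
        by (simp add: mult.commute)
    qed (use D(2)[OF z] in \<open>rule order_trans[OF norm_ge_zero]\<close>)
  qed
  then show ?thesis by simp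
qed

text \<open>Compare the minimizer with the point at parameter t on the segment towards y, cancel F
  x, divide by t and let t tend to 0. The limit is taken by proving the bound with an extra factor z
  = 1 - t for every z in (0, 1). It turns closeness of values into closeness of minimizers.\<close>

lemma strongly_convex_on_growth:
  assumes F: "strongly_convex_on \<alpha> S F" and x: "is_arg_min F (\<lambda>y. y \<in> S) x" and y: "y \<in> S"
  shows "\<alpha> / 2 * (norm (y - x))\<^sup>2 \<le> F y - F x"
proof (rule field_le_mult_one_interval)
  fix z :: real
  assume z: "0 < z" "z < 1"
  define t where "t = 1 - z"
  have t: "0 < t" "t \<le> 1" "z = 1 - t"
    using z by (auto simp: t_def)
  have x': "x \<in> S" "\<And>y. y \<in> S \<Longrightarrow> F x \<le> F y"
    using x by (auto simp: is_arg_min_def not_less)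
  have S: "convex S"
    and F: "F (t *\<^sub>R y + (1 - t) *\<^sub>R x)
      \<le> t * F y + (1 - t) * F x - \<alpha> / 2 * t * (1 - t) * (norm (y - x))\<^sup>2"
    using F x'(1) y t unfolding strongly_convex_on_def by auto
  have "t *\<^sub>R y + (1 - t) *\<^sub>R x \<in> S"
    using S x'(1) y t by (intro convexD) auto
  then have "F x \<le> t * F y + (1 - t) * F x - \<alpha> / 2 * t * (1 - t) * (norm (y - x))\<^sup>2"
    using x'(2) F by (meson order_trans)
  then have "t * (z * (\<alpha> / 2 * (norm (y - x))\<^sup>2)) \<le> t * (F y - F x)"
    by (simp add: t(3) algebra_simps)
  then show "z * (\<alpha> / 2 * (norm (y - x))\<^sup>2) \<le> F y - F x"
    using t by simp
qed

text \<open>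
  One point is taken from each nonempty cell of a grid of mesh \<open>r / sqrt k\<close>; for
  \<open>sqrt k * diameter C < r\<close> a single point suffices, which is why the maximum with \<open>1\<close> appears.
\<close>

lemma exists_net:
  fixes C :: "fseq set"
  assumes C: "C \<subseteq> Rn k" "bounded C" "C \<noteq> {}" and k: "k \<ge> 1" and r: "r > 0"
  obtains E where "finite E" "E \<subseteq> C" "\<And>x. x \<in> C \<Longrightarrow> \<exists>y\<in>E. norm (x - y) \<le> r"
    "real (card E) \<le> max 1 ((4 * (sqrt k * diameter C / r)) ^ k)"
proof -
  define x where "x = sqrt k * diameter C / r"
  define s where "s = r / sqrt k"
  have s: "s > 0" using r k by (simp add: s_def)
  have diam: "norm (x - y) \<le> diameter C" if "x \<in> C" "y \<in> C" for x y
    using diameter_bounded_bound[OF C(2) that] by (simp add: dist_norm)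
  have x0: "x \<ge> 0"
    using r diameter_ge_0[OF C(2)] by (simp add: x_def)
  obtain c where c: "c \<in> C" using C(3) by blast
  show ?thesis
  proof (cases "x < 1")
    case True
    have "diameter C \<le> sqrt k * diameter C"
      using mult_right_mono[of 1 "sqrt k" "diameter C"] k diameter_ge_0[OF C(2)] by simp
    also have "\<dots> \<le> r"
      using True r by (simp add: x_def field_simps)
    finally have "diameter C \<le> r" .
    then show thesis
    proof (intro that[of "{c}"])
      fix x assume "x \<in> C"
      then have "norm (x - c) \<le> r"
        using diam[OF _ c, of x] \<open>diameter C \<le> r\<close> by linarith
      then show "\<exists>y\<in>{c}. norm (x - y) \<le> r" by simp
    qed (use c in auto)
  next
    case False
    \<comment> \<open>\<open>q z\<close> is the grid cell of z, with the grid anchored at a point c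
      of C, so that all quotients lie in [-x, x]. Restricting to the first k coordinates makes the
      cell labels extensional functions, hence countable by \<open>card_PiE\<close>.\<close>
    define q where "q z = (\<lambda>i\<in>{..<k}. \<lfloor>(coord z i - coord c i) / s\<rfloor>)" for z
    define Q where "Q = {..<k} \<rightarrow>\<^sub>E {- \<lfloor>x\<rfloor> - 1..\<lfloor>x\<rfloor>}"
    have abs_coord: "\<bar>coord z i\<bar> \<le> norm z" if "z \<in> Rn k" "i < k" for z i
    proof -
      have "(coord z i)\<^sup>2 \<le> (\<Sum>i<k. (coord z i)\<^sup>2)"
        using that by (intro member_le_sum) auto
      then have "sqrt ((coord z i)\<^sup>2) \<le> norm z"
        unfolding norm_Rn[OF that(1)] by (rule real_sqrt_le_mono)
      then show ?thesis by simp
    qed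
    have diff: "y - z \<in> Rn k" if "y \<in> C" "z \<in> C" for y z
      using C(1) that by (auto simp: Rn_def subset_iff)
    have qQ: "q ` C \<subseteq> Q"
    proof clarify
      fix z assume z: "z \<in> C"
      have "- \<lfloor>x\<rfloor> - 1 \<le> \<lfloor>(coord z i - coord c i) / s\<rfloor> \<and> \<lfloor>(coord z i - coord c i) / s\<rfloor> \<le> \<lfloor>x\<rfloor>"
        if "i < k" for i
      proof -
        have "\<bar>coord z i - coord c i\<bar> \<le> diameter C"
          using abs_coord[OF diff[OF z c] that] diam[OF z c] by simp
        then have "\<bar>(coord z i - coord c i) / s\<bar> \<le> diameter C / s"
          using s by (simp add: divide_right_mono)
        also have "diameter C / s = x"
          by (simp add: s_def x_def mult.commute)
        finally have "- x \<le> (coord z i - coord c i) / s" "(coord z i - coord c i) / s \<le> x"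
          by linarith+
        then show ?thesis
          by linarith
      qed
      then show "q z \<in> Q"
        by (auto simp: q_def Q_def)
    qed
    have fQ: "finite Q"
      by (auto simp: Q_def intro: finite_PiE)
    have "card Q = nat (2 * \<lfloor>x\<rfloor> + 2) ^ k"
      using x0 by (simp add: Q_def card_PiE algebra_simps)
    then have "real (card Q) = (2 * real_of_int \<lfloor>x\<rfloor> + 2) ^ k"
      using x0 by simp
    \<comment> \<open>Each coordinate has 2 \<lfloor>x\<rfloor> + 2 possible labels, and the
      additive 2 is at most 2x because x \<ge> 1 in this case.\<close>
    also have "\<dots> \<le> (4 * x) ^ k"
      using False x0 by (intro power_mono) linarith+
    finally have cQ: "real (card Q) \<le> (4 * x) ^ k" .
    \<comment> \<open>Representatives are chosen inside C rather than as cell centres, since the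
      moment hypotheses to be used at net points hold only on C.\<close>
    define E where "E = inv_into C q ` (q ` C)"
    have "finite (q ` C)"
      using qQ fQ by (rule finite_subset)
    then have "finite E" "card E \<le> card (q ` C)"
      by (auto simp: E_def intro: card_image_le)
    moreover have "card (q ` C) \<le> card Q"
      using qQ fQ by (intro card_mono)
    ultimately have "real (card E) \<le> max 1 ((4 * x) ^ k)"
      using cQ by linarith
    moreover have "E \<subseteq> C"
      by (auto simp: E_def intro: inv_into_into)
    moreover have "\<exists>y\<in>E. norm (z - y) \<le> r" if z: "z \<in> C" for z
    proof
      define y where "y = inv_into C q (q z)"
      show "y \<in> E"
        using z by (simp add: E_def y_def)
      have y: "y \<in> C" "q y = q z"
        using z by (auto simp: y_def inv_into_into f_inv_into_f)
      have "(coord (z - y) i)\<^sup>2 \<le> s\<^sup>2" if "i < k" for i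
      proof -
        have "\<lfloor>(coord z i - coord c i) / s\<rfloor> = \<lfloor>(coord y i - coord c i) / s\<rfloor>"
          using fun_cong[OF y(2), of i] that by (simp add: q_def)
        then have "\<bar>(coord z i - coord c i) / s - (coord y i - coord c i) / s\<bar> \<le> 1"
          by linarith
        also have "(coord z i - coord c i) / s - (coord y i - coord c i) / s = coord (z - y) i / s"
          by (simp flip: diff_divide_distrib)
        finally have "\<bar>coord (z - y) i\<bar> \<le> s"
          using s by (simp add: abs_divide)
        then show ?thesis
          using s by (simp add: power2_le_iff_abs_le)
      qed
      then have "(\<Sum>i<k. (coord (z - y) i)\<^sup>2) \<le> (\<Sum>i<k. s\<^sup>2)"
        by (intro sum_mono) simp
      also have "\<dots> = r\<^sup>2"
        using k by (simp add: s_def power_divide)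
      finally show "norm (z - y) \<le> r"
        unfolding norm_Rn[OF diff[OF z y(1)]] using r by (intro real_le_lsqrt) auto
    qed
    ultimately show thesis
      using \<open>finite E\<close> unfolding x_def by (intro that[of E]) blast+
  qed
qed

section \<open>Measurability of minimizers\<close>

lemma compact_countable_dense_subset:
  fixes K :: "'a::metric_space set"
  assumes "compact K"
  obtains E where "countable E" "E \<subseteq> K" "\<forall>x\<in>K. \<forall>e>0. \<exists>y\<in>E. dist x y < e"
proof -
  have "\<forall>e>0. \<exists>k. finite k \<and> k \<subseteq> K \<and> K \<subseteq> (\<Union>x\<in>k. ball x e)"
    using assms by (intro seq_compact_imp_totally_bounded compact_imp_seq_compact)
  then have "\<forall>n::nat. \<exists>k. finite k \<and> k \<subseteq> K \<and> K \<subseteq> (\<Union>x\<in>k. ball x (1 / Suc n))"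
    by simp
  then obtain k where k: "\<And>n::nat. finite (k n)" "\<And>n. k n \<subseteq> K"
      "\<And>n::nat. K \<subseteq> (\<Union>x\<in>k n. ball x (1 / Suc n))"
    by metis
  show ?thesis
  proof (rule that[of "\<Union>n. k n"], safe)
    fix x :: 'a and e :: real
    assume "x \<in> K" "e > 0"
    then obtain n where n: "1 / Suc n < e"
      using nat_approx_posE by blast
    obtain y where "y \<in> k n" "dist y x < 1 / Suc n"
      using k(3)[of n] \<open>x \<in> K\<close> by (auto simp: mem_ball)
    then show "\<exists>y\<in>\<Union>n. k n. dist x y < e"
      using n by (intro bexI[of _ y]) (auto simp: dist_commute)
  qed (use k in \<open>auto intro: countable_finite\<close>)
qed

lemma continuous_on_less_nearby:
  fixes F :: "'a::metric_space \<Rightarrow> real"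
  assumes "continuous_on K F" "x \<in> K" "F x < r"
  obtains e where "e > 0" "\<forall>y\<in>K. dist x y < e \<longrightarrow> F y < r"
proof -
  from assms obtain e where "e > 0" "\<And>y. y \<in> K \<Longrightarrow> dist y x < e \<Longrightarrow> dist (F y) (F x) < r - F x"
    unfolding continuous_on_iff by (metis diff_gt_0_iff_gt)
  then have "F y < r" if "y \<in> K" "dist x y < e" for y
    using that by (fastforce simp: dist_real_def dist_commute)
  with \<open>e > 0\<close> show ?thesis
    using that by blast
qed

text \<open>
  Needed because \<^const>\<open>measure\<close> is \<open>0\<close> on non-measurable sets. The unique minimizer avoids \<open>K\<close> iff a
  rational separates the value at some point of a countable dense subset of \<open>C\<close> from the values on a
  countable dense subset of \<open>K\<close>.
\<close>

lemma arg_min_avoids_compact_measurable: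
  fixes F :: "'w \<Rightarrow> 'a::metric_space \<Rightarrow> real"
  assumes C: "compact C" and K: "compact K" "K \<subseteq> C"
    and meas: "\<And>x. x \<in> C \<Longrightarrow> (\<lambda>\<omega>. F \<omega> x) \<in> borel_measurable \<Omega>"
    and cont: "\<And>\<omega>. \<omega> \<in> space \<Omega> \<Longrightarrow> continuous_on C (F \<omega>)"
    and argmin: "\<And>\<omega>. \<omega> \<in> space \<Omega> \<Longrightarrow> is_unique_arg_min_on (F \<omega>) C (\<theta> \<omega>)"
  shows "{\<omega> \<in> space \<Omega>. \<theta> \<omega> \<notin> K} \<in> sets \<Omega>"
proof -
  obtain E where E: "countable E" "E \<subseteq> C" "\<forall>x\<in>C. \<forall>e>0. \<exists>y\<in>E. dist x y < e"
    using compact_countable_dense_subset[OF C] .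
  obtain E' where E': "countable E'" "E' \<subseteq> K" "\<forall>x\<in>K. \<forall>e>0. \<exists>y\<in>E'. dist x y < e"
    using compact_countable_dense_subset[OF K(1)] .
  have "\<theta> \<omega> \<notin> K \<longleftrightarrow> (\<exists>q\<in>\<rat>. \<exists>x\<in>E. F \<omega> x < q \<and> (\<forall>y\<in>E'. q \<le> F \<omega> y))"
    if \<omega>: "\<omega> \<in> space \<Omega>" for \<omega>
  proof -
    have \<theta>: "\<theta> \<omega> \<in> C" "\<And>y. y \<in> C \<Longrightarrow> F \<omega> (\<theta> \<omega>) \<le> F \<omega> y"
        "\<And>y. y \<in> C \<Longrightarrow> (\<And>z. z \<in> C \<Longrightarrow> F \<omega> y \<le> F \<omega> z) \<Longrightarrow> y = \<theta> \<omega>"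
      using argmin[OF \<omega>] by (auto simp: is_unique_arg_min_on_def is_arg_min_def not_less)
    note contC = cont[OF \<omega>]
    have contK: "continuous_on K (F \<omega>)"
      using contC K(2) continuous_on_subset by blast
    show ?thesis
    proof
      assume notin: "\<theta> \<omega> \<notin> K"
      \<comment> \<open>If K is nonempty, b is the minimum over K: compactness makes it attained,
        and uniqueness of the minimizer over C makes the gap strict. For empty K any larger number
        serves.\<close>
      obtain b where b: "F \<omega> (\<theta> \<omega>) < b" "\<And>y. y \<in> K \<Longrightarrow> b \<le> F \<omega> y"
      proof (cases "K = {}")
        case True
        show thesis
          by (rule that[of "F \<omega> (\<theta> \<omega>) + 1"]) (use True in auto)
      next
        case False
        then obtain x where x: "x \<in> K" "\<And>y. y \<in> K \<Longrightarrow> F \<omega> x \<le> F \<omega> y"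
          using continuous_attains_inf[OF K(1) _ contK] by blast
        have "F \<omega> (\<theta> \<omega>) < F \<omega> x"
        proof (rule ccontr)
          assume "\<not> F \<omega> (\<theta> \<omega>) < F \<omega> x"
          then have "x = \<theta> \<omega>"
            using x(1) K(2) \<theta>(2) by (intro \<theta>(3)) force+
          then show False
            using x(1) notin by simp
        qed
        then show thesis
          using x(2) by (rule that)
      qed
      \<comment> \<open>The rational keeps the quantifier countable, and the strict inequality below
        it survives, by continuity, the move from the minimizer to a nearby point of E.\<close>
      obtain q where q: "q \<in> \<rat>" "F \<omega> (\<theta> \<omega>) < q" "q < b"
        using Rats_dense_in_real[OF b(1)] by blast
      obtain e where e: "e > 0" "\<forall>y\<in>C. dist (\<theta> \<omega>) y < e \<longrightarrow> F \<omega> y < q"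
        using continuous_on_less_nearby[OF contC \<theta>(1) q(2)] .
      obtain x where "x \<in> E" "dist (\<theta> \<omega>) x < e"
        using E(3) \<theta>(1) e(1) by blast
      then have "x \<in> E" "F \<omega> x < q"
        using e(2) E(2) by auto
      moreover have "\<forall>y\<in>E'. q \<le> F \<omega> y"
        using q(3) b(2) E'(2) by force
      ultimately show "\<exists>q\<in>\<rat>. \<exists>x\<in>E. F \<omega> x < q \<and> (\<forall>y\<in>E'. q \<le> F \<omega> y)"
        using q(1) by blast
    next
      assume "\<exists>q\<in>\<rat>. \<exists>x\<in>E. F \<omega> x < q \<and> (\<forall>y\<in>E'. q \<le> F \<omega> y)"
      then obtain q x where q: "x \<in> E" "F \<omega> x < q" "\<And>y. y \<in> E' \<Longrightarrow> q \<le> F \<omega> y"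
        by blast
      have less: "F \<omega> (\<theta> \<omega>) < q"
        using \<theta>(2)[of x] q E(2) by force
      show "\<theta> \<omega> \<notin> K"
      proof
        assume \<theta>K: "\<theta> \<omega> \<in> K"
        \<comment> \<open>A minimizer inside K would have points of the dense set E' nearby, with
          values below q. This is why E' has to be dense in K itself.\<close>
        obtain e where e: "e > 0" "\<forall>y\<in>K. dist (\<theta> \<omega>) y < e \<longrightarrow> F \<omega> y < q"
          using continuous_on_less_nearby[OF contK \<theta>K less] .
        obtain y where "y \<in> E'" "dist (\<theta> \<omega>) y < e"
          using E'(3) \<theta>K e(1) by blast
        then show False
          using e(2) q(3)[of y] E'(2) by force
      qed
    qed
  qed
  then have "{\<omega> \<in> space \<Omega>. \<theta> \<omega> \<notin> K} =
      {\<omega> \<in> space \<Omega>. \<exists>q\<in>\<rat>. \<exists>x\<in>E. F \<omega> x < q \<and> (\<forall>y\<in>E'. q \<le> F \<omega> y)}"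
    by blast
  also have "\<dots> \<in> sets \<Omega>"
    by (intro sets.sets_Collect_countable_Ex' sets.sets_Collect_conj sets.sets_Collect_countable_All'
          borel_measurable_less borel_measurable_le measurable_const meas countable_rat E(1) E'(1))
       (use E(2) E'(2) K(2) in auto)
  finally show ?thesis .
qed

section \<open>Concentration of the minimizer\<close>

text \<open>This is the analytic core, with all hypotheses pulled back to \<Omega> and explicit
  constants: 4096 = 64 * 8^2 comes from the tail bound at deviation \<tau>/8, and 96 = 4 * 24 from
  the net bound at radius \<tau>/(24 L), where \<tau> =
  \<open>\<alpha> * \<epsilon>\<^sup>2\<close>.\<close>

lemma minimizer_concentration:
  fixes f :: "fseq \<Rightarrow> fseq \<Rightarrow> real" and g :: "fseq \<Rightarrow> real"
  assumes "prob_space \<Omega>" and N: "N \<ge> 1" and k: "k \<ge> 1"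
    and \<eta>: "\<And>i j. i \<in> {1..N} \<Longrightarrow> j \<in> {1..N} \<Longrightarrow> \<eta> i j \<in> measurable \<Omega> (borel_Rn m)"
    and ind: "indep_off_shared_index \<Omega> m N \<eta>"
    and C: "C \<subseteq> Rn k" "C \<noteq> {}" "compact C"
    and f: "\<And>\<theta>. \<theta> \<in> C \<Longrightarrow> f \<theta> \<in> borel_measurable (borel_Rn m)"
    and f_int: "\<And>\<theta> i j. \<theta> \<in> C \<Longrightarrow> i \<in> {1..N} \<Longrightarrow> j \<in> {1..N} \<Longrightarrow> integrable \<Omega> (\<lambda>\<omega>. f \<theta> (\<eta> i j \<omega>))"
    and \<mu>: "\<And>\<theta> i j. \<theta> \<in> C \<Longrightarrow> i \<in> {1..N} \<Longrightarrow> j \<in> {1..N} \<Longrightarrow> (\<integral>\<omega>. f \<theta> (\<eta> i j \<omega>) \<partial>\<Omega>) = \<mu> i j \<theta>"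
    and f_exp: "\<And>\<theta> i j. \<theta> \<in> C \<Longrightarrow> i \<in> {1..N} \<Longrightarrow> j \<in> {1..N} \<Longrightarrow>
        integrable \<Omega> (\<lambda>\<omega>. exp \<bar>f \<theta> (\<eta> i j \<omega>) - \<mu> i j \<theta>\<bar>)"
    and M: "\<And>\<theta> i j. \<theta> \<in> C \<Longrightarrow> i \<in> {1..N} \<Longrightarrow> j \<in> {1..N} \<Longrightarrow>
        (\<integral>\<omega>. exp \<bar>f \<theta> (\<eta> i j \<omega>) - \<mu> i j \<theta>\<bar> \<partial>\<Omega>) \<le> M"
    and g: "g \<in> borel_measurable (borel_Rn m)"
    and g_exp: "\<And>i j. i \<in> {1..N} \<Longrightarrow> j \<in> {1..N} \<Longrightarrow> integrable \<Omega> (\<lambda>\<omega>. exp (g (\<eta> i j \<omega>)))"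
    and L: "\<And>i j. i \<in> {1..N} \<Longrightarrow> j \<in> {1..N} \<Longrightarrow> (\<integral>\<omega>. exp (g (\<eta> i j \<omega>)) \<partial>\<Omega>) \<le> L"
    and f_grad: "\<And>\<theta> y. \<theta> \<in> C \<Longrightarrow> y \<in> Rn m \<Longrightarrow> \<exists>D. has_gradient k (\<lambda>\<theta>'. f \<theta>' y) \<theta> D \<and> norm D \<le> g y"
    and \<mu>_grad: "\<And>\<theta> i j. \<theta> \<in> C \<Longrightarrow> i \<in> {1..N} \<Longrightarrow> j \<in> {1..N} \<Longrightarrow>
        \<exists>D. has_gradient k (\<mu> i j) \<theta> D \<and> norm D \<le> L"
    and \<theta>\<^sub>s: "is_unique_arg_min_on (F_mean \<Omega> N f \<eta>) C \<theta>\<^sub>s"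
    and \<theta>\<^sub>h: "\<And>\<omega>. \<omega> \<in> space \<Omega> \<Longrightarrow> is_unique_arg_min_on (F_hat N f \<eta> \<omega>) C (\<theta>\<^sub>h \<omega>)"
    and \<alpha>: "\<alpha> > 0" "strongly_convex_on \<alpha> C (F_mean \<Omega> N f \<eta>)"
    and \<epsilon>: "0 < \<epsilon>" "\<alpha> * \<epsilon>\<^sup>2 < 1" and \<delta>: "0 < \<delta>" "\<delta> < 1"
    and N_large: "real N > 4096 * M / (\<alpha>\<^sup>2 * \<epsilon>^4) *
        ln (3 / \<delta> * max 1 ((96 * sqrt (real k) * diameter C * L / (\<alpha> * \<epsilon>\<^sup>2)) ^ k))"
  shows "measure \<Omega> {\<omega> \<in> space \<Omega>. norm (\<theta>\<^sub>h \<omega> - \<theta>\<^sub>s) < \<epsilon>} \<ge> 1 - \<delta>"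
proof -
  interpret prob_space \<Omega> by fact
  have convC: "convex C"
    using \<alpha>(2) by (simp add: strongly_convex_on_def)
  have \<eta>_Rn: "\<eta> i j \<omega> \<in> Rn m" if "i \<in> {1..N}" "j \<in> {1..N}" "\<omega> \<in> space \<Omega>" for i j \<omega>
    using measurable_space[OF \<eta>[OF that(1,2)] that(3)] by (simp add: borel_Rn_def space_restrict_space)
  obtain \<theta>0 where \<theta>0: "\<theta>0 \<in> C"
    using C(2) by blast
  have one: "1 \<in> {1..N}"
    using N by simp
  have g_nonneg: "g y \<ge> 0" if "y \<in> Rn m" for y
    using f_grad[OF \<theta>0 that] norm_ge_zero order_trans by blast
  have M1: "M \<ge> 1"
  proof -
    have "1 \<le> (\<integral>\<omega>. exp \<bar>f \<theta>0 (\<eta> 1 1 \<omega>) - \<mu> 1 1 \<theta>0\<bar> \<partial>\<Omega>)"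
      by (intro integral_ge_const f_exp \<theta>0 one AE_I2) simp
    then show ?thesis
      using M[OF \<theta>0 one one] by linarith
  qed
  have L1: "L \<ge> 1"
  proof -
    have "1 \<le> (\<integral>\<omega>. exp (g (\<eta> 1 1 \<omega>)) \<partial>\<Omega>)"
      by (intro integral_ge_const g_exp one AE_I2) (use g_nonneg \<eta>_Rn one in auto)
    then show ?thesis
      using L[OF one one] by linarith
  qed

  define F where "F \<theta> = array_mean N (\<lambda>i j. \<mu> i j \<theta>)" for \<theta>
  define G where "G \<omega> = array_mean N (\<lambda>i j. g (\<eta> i j \<omega>))" for \<omega>
  let ?F = "F_hat N f \<eta>"
  have F_mean: "F_mean \<Omega> N f \<eta> \<theta> = F \<theta>" if "\<theta> \<in> C" for \<theta>
    unfolding F_mean_def F_hat_eq F_def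
    using f_int \<mu> that by (subst integral_array_mean) (auto simp: array_mean_def)
  have F_lip: "\<bar>F x - F y\<bar> \<le> L * norm (x - y)" if "x \<in> C" "y \<in> C" for x y
  proof -
    have "\<bar>F x - F y\<bar> \<le> array_mean N (\<lambda>_ _. L * norm (x - y))"
      unfolding F_def
      by (intro array_mean_abs_le lipschitz_of_has_gradient[OF convC C(1) _ that] \<mu>_grad)
    then show ?thesis
      using N by simp
  qed
  have Fh_lip: "\<bar>?F \<omega> x - ?F \<omega> y\<bar> \<le> G \<omega> * norm (x - y)"
    if "\<omega> \<in> space \<Omega>" "x \<in> C" "y \<in> C" for \<omega> x y
  proof -
    have "\<bar>?F \<omega> x - ?F \<omega> y\<bar> \<le> array_mean N (\<lambda>i j. g (\<eta> i j \<omega>) * norm (x - y))"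
      unfolding F_hat_eq
      by (intro array_mean_abs_le f_grad \<eta>_Rn that(1)
            lipschitz_of_has_gradient[where h="\<lambda>\<theta>. f \<theta> _", OF convC C(1) _ that(2,3)])
    then show ?thesis
      by (simp add: array_mean_mult_right G_def)
  qed
  have G_nonneg: "G \<omega> \<ge> 0" if "\<omega> \<in> space \<Omega>" for \<omega>
    unfolding G_def array_mean_def
    by (intro divide_nonneg_nonneg sum_nonneg g_nonneg \<eta>_Rn that) auto
  have Fh_cont: "continuous_on C (?F \<omega>)" if "\<omega> \<in> space \<Omega>" for \<omega>
    using Fh_lip[OF that] G_nonneg[OF that]
    by (intro lipschitz_on_continuous_on[where L="G \<omega>"] lipschitz_onI) (auto simp: dist_norm)
  have Fh_meas: "(\<lambda>\<omega>. ?F \<omega> \<theta>) \<in> borel_measurable \<Omega>" if "\<theta> \<in> C" for \<theta>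
    unfolding F_hat_eq
    by (intro borel_measurable_array_mean measurable_compose[OF \<eta> f] that)
  have G_meas: "G \<in> borel_measurable \<Omega>"
    unfolding G_def by (intro borel_measurable_array_mean measurable_compose[OF \<eta> g])

  have \<theta>h_C: "\<theta>\<^sub>h \<omega> \<in> C" "\<And>y. y \<in> C \<Longrightarrow> ?F \<omega> (\<theta>\<^sub>h \<omega>) \<le> ?F \<omega> y" if "\<omega> \<in> space \<Omega>" for \<omega>
    using \<theta>\<^sub>h[OF that] by (auto simp: is_unique_arg_min_on_def is_arg_min_def not_less)
  have \<theta>s_C: "is_arg_min (F_mean \<Omega> N f \<eta>) (\<lambda>y. y \<in> C) \<theta>\<^sub>s" "\<theta>\<^sub>s \<in> C"
    using \<theta>\<^sub>s by (auto simp: is_unique_arg_min_on_def is_arg_min_def)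

  have good_sets: "{\<omega> \<in> space \<Omega>. norm (\<theta>\<^sub>h \<omega> - \<theta>\<^sub>s) < \<epsilon>} \<in> sets \<Omega>"
  proof -
    \<comment> \<open>The target event says that the empirical minimizer avoids this compact set.
      Its measurability is what allows monotonicity of the measure at the end.\<close>
    define K where "K = C - ball \<theta>\<^sub>s \<epsilon>"
    have "{\<omega> \<in> space \<Omega>. \<theta>\<^sub>h \<omega> \<notin> K} \<in> sets \<Omega>"
      by (rule arg_min_avoids_compact_measurable[OF C(3) _ _ Fh_meas Fh_cont \<theta>\<^sub>h])
         (auto simp: K_def intro: compact_diff C(3))
    also have "{\<omega> \<in> space \<Omega>. \<theta>\<^sub>h \<omega> \<notin> K} = {\<omega> \<in> space \<Omega>. norm (\<theta>\<^sub>h \<omega> - \<theta>\<^sub>s) < \<epsilon>}"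
      using \<theta>h_C(1) by (auto simp: K_def dist_norm norm_minus_commute)
    finally show ?thesis .
  qed

  define \<tau> where "\<tau> = \<alpha> * \<epsilon>\<^sup>2"
  have \<tau>: "0 < \<tau>" "\<tau> < 1"
    using \<alpha> \<epsilon> by (auto simp: \<tau>_def)
  \<comment> \<open>The aim is a uniform deviation below \<tau>/4. Net points contribute \<tau>/8;
    passing to a general point costs 2 L r for the empirical objective and L r for its mean,
    together 3 L r = \<tau>/8.\<close>
  define r where "r = \<tau> / (24 * L)"
  have r: "r > 0"
    using \<tau> L1 by (simp add: r_def)
  define B where "B = max 1 ((96 * sqrt (real k) * diameter C * L / (\<alpha> * \<epsilon>\<^sup>2)) ^ k)"
  have B1: "B \<ge> 1"
    by (simp add: B_def)
  obtain E where E: "finite E" "E \<subseteq> C" "\<And>x. x \<in> C \<Longrightarrow> \<exists>y\<in>E. norm (x - y) \<le> r"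
      "real (card E) \<le> max 1 ((4 * (sqrt k * diameter C / r)) ^ k)"
    using exists_net[OF C(1) compact_imp_bounded[OF C(3)] C(2) k r] by blast
  have "4 * (sqrt k * diameter C / r) = 96 * sqrt (real k) * diameter C * L / (\<alpha> * \<epsilon>\<^sup>2)"
    by (simp add: r_def \<tau>_def)
  then have cE: "real (card E) \<le> B"
    using E(4) by (simp add: B_def)

  define bad_pt where "bad_pt \<theta> = {\<omega> \<in> space \<Omega>. \<tau> / 8 \<le> \<bar>?F \<omega> \<theta> - F \<theta>\<bar>}" for \<theta>
  define bad_g where "bad_g = {\<omega> \<in> space \<Omega>. 2 * L \<le> G \<omega>}"
  define bad where "bad = bad_g \<union> (\<Union>\<theta>\<in>E. bad_pt \<theta>)"
  have bad_pt_sets: "bad_pt \<theta> \<in> sets \<Omega>" if "\<theta> \<in> E" for \<theta>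
  proof -
    have [measurable]: "(\<lambda>\<omega>. ?F \<omega> \<theta>) \<in> borel_measurable \<Omega>"
      using Fh_meas E(2) that by blast
    show ?thesis
      unfolding bad_pt_def by measurable
  qed
  have bad_g_sets: "bad_g \<in> sets \<Omega>"
    unfolding bad_g_def using G_meas by measurable
  have bad_sets: "bad \<in> sets \<Omega>"
    unfolding bad_def using bad_g_sets bad_pt_sets E(1) by auto

  have good: "norm (\<theta>\<^sub>h \<omega> - \<theta>\<^sub>s) < \<epsilon>" if \<omega>: "\<omega> \<in> space \<Omega>" "\<omega> \<notin> bad" for \<omega>
  proof -
    have G: "G \<omega> \<le> 2 * L"
      using \<omega> by (auto simp: bad_def bad_g_def)
    have dev: "\<bar>?F \<omega> x - F x\<bar> < \<tau> / 4" if x: "x \<in> C" for x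
    proof -
      obtain y where y: "y \<in> E" "norm (x - y) \<le> r"
        using E(3)[OF x] by blast
      have yC: "y \<in> C"
        using y E(2) by blast
      have "\<bar>?F \<omega> y - F y\<bar> < \<tau> / 8"
        using \<omega> y(1) by (auto simp: bad_def bad_pt_def)
      moreover have "\<bar>?F \<omega> x - ?F \<omega> y\<bar> \<le> 2 * L * r"
        using Fh_lip[OF \<omega>(1) x yC] mult_mono[OF G y(2)] L1 by simp
      moreover have "\<bar>F x - F y\<bar> \<le> L * r"
        by (rule order_trans[OF F_lip[OF x yC] mult_left_mono[OF y(2)]]) (use L1 in simp)
      moreover have "L * r = \<tau> / 24"
        using L1 by (simp add: r_def)
      ultimately show ?thesis
        by linarith
    qed
    have "\<alpha> / 2 * (norm (\<theta>\<^sub>h \<omega> - \<theta>\<^sub>s))\<^sup>2 \<le> F (\<theta>\<^sub>h \<omega>) - F \<theta>\<^sub>s"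
      using strongly_convex_on_growth[OF \<alpha>(2) \<theta>s_C(1) \<theta>h_C(1)[OF \<omega>(1)]]
      by (simp add: F_mean \<theta>h_C(1)[OF \<omega>(1)] \<theta>s_C(2))
    also have "\<dots> < \<tau> / 2"
      \<comment> \<open>Exchange F for its empirical version at both minimizers, at a cost below
        \<tau>/4 each; the remaining empirical difference is at most 0 by minimality of
        \<open>\<theta>\<^sub>h \<omega>\<close>.\<close>
      using dev[OF \<theta>h_C(1)[OF \<omega>(1)]] dev[OF \<theta>s_C(2)] \<theta>h_C(2)[OF \<omega>(1) \<theta>s_C(2)] by linarith
    also have "\<tau> / 2 = \<alpha> / 2 * \<epsilon>\<^sup>2"
      by (simp add: \<tau>_def)
    finally have "(norm (\<theta>\<^sub>h \<omega> - \<theta>\<^sub>s))\<^sup>2 < \<epsilon>\<^sup>2"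
      using \<alpha>(1) by simp
    then show ?thesis
      using \<epsilon>(1) by (simp add: power_less_imp_less_base)
  qed

  have \<tau>2: "\<alpha>\<^sup>2 * \<epsilon> ^ 4 = \<tau>\<^sup>2"
    by (simp add: \<tau>_def power_mult_distrib flip: power_mult)
  have N1: "ln (3 / \<delta> * B) \<le> \<tau>\<^sup>2 * real N / (4096 * M)"
    using N_large M1 \<tau> unfolding \<tau>2 B_def[symmetric] by (simp add: field_simps)
  \<comment> \<open>With \<tau> < 1 and M \<ge> 1, the lower bound on N also covers the coarser tail
    exp(-N) of the Lipschitz event.\<close>
  have "\<tau>\<^sup>2 * real N / (4096 * M) \<le> real N"
  proof -
    have "\<tau>\<^sup>2 \<le> 1"
      using \<tau> by (simp add: power_le_one)
    then have "\<tau>\<^sup>2 * real N \<le> 1 * real N"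
      by (intro mult_right_mono) auto
    also have "\<dots> \<le> real N * (4096 * M)"
      using M1 mult_left_mono[of 1 "4096 * M" "real N"] by simp
    finally show ?thesis
      using M1 by (simp add: field_simps)
  qed
  with N1 have N2: "ln (3 / \<delta> * B) \<le> real N"
    by linarith
  have expB: "exp (- x) \<le> \<delta> / (3 * B)" if "ln (3 / \<delta> * B) \<le> x" for x
  proof -
    have "exp (- x) \<le> exp (- ln (3 / \<delta> * B))"
      using that by simp
    also have "\<dots> = \<delta> / (3 * B)"
      using B1 \<delta> by (simp add: exp_minus)
    finally show ?thesis .
  qed

  have "prob bad_g \<le> exp (- real N)"
    unfolding bad_g_def G_def
    by (rule array_mean_exceeds_tail[OF assms(1) ind N \<eta> g g_exp L L1])
  also have "\<dots> \<le> \<delta> / (3 * B)"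
    by (rule expB[OF N2])
  also have "\<dots> \<le> \<delta> / 3"
    using B1 \<delta> by (simp add: field_simps)
  finally have p_g: "prob bad_g \<le> \<delta> / 3" .
  have p_pt: "prob (bad_pt \<theta>) \<le> 2 * (\<delta> / (3 * B))" if "\<theta> \<in> E" for \<theta>
  proof -
    have \<theta>: "\<theta> \<in> C"
      using that E(2) by blast
    have "prob (bad_pt \<theta>) \<le> 2 * exp (- ((\<tau> / 8)\<^sup>2 * real N / (64 * M)))"
      unfolding bad_pt_def F_hat_eq F_def
      by (rule array_deviation_tail[OF assms(1) ind N \<eta> f[OF \<theta>] f_int[OF \<theta>] \<mu>[OF \<theta>] f_exp[OF \<theta>] M[OF \<theta>] M1])
         (use \<tau> in auto)
    also have "(\<tau> / 8)\<^sup>2 * real N / (64 * M) = \<tau>\<^sup>2 * real N / (4096 * M)"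
      by (simp add: power_divide)
    also have "2 * exp (- (\<tau>\<^sup>2 * real N / (4096 * M))) \<le> 2 * (\<delta> / (3 * B))"
      by (intro mult_left_mono expB N1) auto
    finally show ?thesis .
  qed
  \<comment> \<open>The 3 inside the logarithm splits \<delta>: one third for the Lipschitz event,
    two thirds for the two-sided tails at the at most B net points.\<close>
  have "prob bad \<le> prob bad_g + prob (\<Union>\<theta>\<in>E. bad_pt \<theta>)"
    unfolding bad_def using bad_g_sets bad_pt_sets E(1) by (intro measure_Un_le) auto
  also have "prob (\<Union>\<theta>\<in>E. bad_pt \<theta>) \<le> (\<Sum>\<theta>\<in>E. prob (bad_pt \<theta>))"
    using bad_pt_sets E(1) by (intro finite_measure_subadditive_finite) auto
  also have "\<dots> \<le> (\<Sum>\<theta>\<in>E. 2 * (\<delta> / (3 * B)))"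
    by (intro sum_mono p_pt)
  also have "\<dots> = card E * (2 * (\<delta> / (3 * B)))"
    by simp
  also have "\<dots> \<le> B * (2 * (\<delta> / (3 * B)))"
    using cE B1 \<delta> by (intro mult_right_mono) auto
  also have "\<dots> = 2 * \<delta> / 3"
    using B1 by simp
  finally have "prob bad \<le> \<delta>"
    using p_g by linarith
  then have "1 - \<delta> \<le> prob (space \<Omega> - bad)"
    using prob_compl[OF bad_sets] by simp
  also have "\<dots> \<le> prob {\<omega> \<in> space \<Omega>. norm (\<theta>\<^sub>h \<omega> - \<theta>\<^sub>s) < \<epsilon>}"
    using good good_sets by (intro finite_measure_mono) auto
  finally show ?thesis .
qed

text \<open>Integrability is stated next to each bound because a Bochner integral of a
  non-integrable function is 0, which would make the bound hold for the wrong reason. The relatively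
  open U is there because the gradient of the expectation at a point of C involves nearby parameters
  outside C, where the expectation has to exist too.\<close>

theorem lemma4p3:
  shows "\<exists>C\<^sub>1>0. \<exists>C\<^sub>2>0.
    \<forall>(k::nat) (m::nat) (N::nat) (\<Omega> :: 'w measure)
      (f :: fseq \<Rightarrow> fseq \<Rightarrow> real) (P :: nat \<Rightarrow> nat \<Rightarrow> fseq measure)
      (\<eta> :: nat \<Rightarrow> nat \<Rightarrow> 'w \<Rightarrow> fseq) (C :: fseq set) (\<alpha>::real) (M::real) (L::real)
      (\<theta>\<^sub>s :: fseq) (\<theta>\<^sub>h :: 'w \<Rightarrow> fseq).
      k \<ge> 1 \<and> m \<ge> 1 \<and> N \<ge> 1 \<and> prob_space \<Omega> \<and>
      (\<forall>i\<in>{1..N}. \<forall>j\<in>{1..N}.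
         prob_space (P i j) \<and> sets (P i j) = sets (borel_Rn m) \<and>
         \<eta> i j \<in> measurable \<Omega> (borel_Rn m) \<and> distr \<Omega> (borel_Rn m) (\<eta> i j) = P i j) \<and>
      C \<subseteq> Rn k \<and> C \<noteq> {} \<and> compact C \<and>
      (\<exists>U. openin (top_of_set (Rn k)) U \<and> C \<subseteq> U \<and>
         (\<forall>\<theta>\<in>U. \<forall>i\<in>{1..N}. \<forall>j\<in>{1..N}. integrable (P i j) (f \<theta>))) \<and>
      indep_off_shared_index \<Omega> m N \<eta> \<and>
      is_unique_arg_min_on (F_mean \<Omega> N f \<eta>) C \<theta>\<^sub>s \<and>
      (\<forall>\<omega>\<in>space \<Omega>. is_unique_arg_min_on (F_hat N f \<eta> \<omega>) C (\<theta>\<^sub>h \<omega>)) \<and>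
      \<alpha> > 0 \<and> strongly_convex_on \<alpha> C (F_mean \<Omega> N f \<eta>) \<and>
      (\<forall>\<theta>\<in>C. \<forall>i\<in>{1..N}. \<forall>j\<in>{1..N}.
         integrable (P i j) (\<lambda>y. exp \<bar>f \<theta> y - (\<integral>z. f \<theta> z \<partial>P i j)\<bar>) \<and>
         (\<integral>y. exp \<bar>f \<theta> y - (\<integral>z. f \<theta> z \<partial>P i j)\<bar> \<partial>P i j) < M) \<and>
      (\<exists>g :: fseq \<Rightarrow> real.
         (\<forall>\<theta>\<in>C. \<forall>y\<in>Rn m. \<exists>D. has_gradient k (\<lambda>\<theta>'. f \<theta>' y) \<theta> D \<and> norm D \<le> g y) \<and>
         (\<forall>\<theta>\<in>C. \<forall>i\<in>{1..N}. \<forall>j\<in>{1..N}.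
            integrable (P i j) g \<and>
            (\<exists>D. has_gradient k (\<lambda>\<theta>'. \<integral>y. f \<theta>' y \<partial>P i j) \<theta> D \<and> norm D \<le> (\<integral>y. g y \<partial>P i j)) \<and>
            integrable (P i j) (\<lambda>y. exp (g y)) \<and> (\<integral>y. exp (g y) \<partial>P i j) < L))
      \<longrightarrow>
      (\<forall>\<epsilon> \<delta>. 0 < \<epsilon> \<and> \<epsilon> < \<alpha> powr (-1/2) \<and> 0 < \<delta> \<and> \<delta> < 1 \<and>
         real N > C\<^sub>1 * M / (\<alpha>\<^sup>2 * \<epsilon>^4) *
           ln (3 / \<delta> * max 1 ((C\<^sub>2 * sqrt (real k) * diameter C * L / (\<alpha> * \<epsilon>\<^sup>2)) ^ k))
         \<longrightarrow> measure \<Omega> {\<omega> \<in> space \<Omega>. norm (\<theta>\<^sub>h \<omega> - \<theta>\<^sub>s) < \<epsilon>} \<ge> 1 - \<delta>)"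
proof -
  have main: "measure \<Omega> {\<omega> \<in> space \<Omega>. norm (\<theta>\<^sub>h \<omega> - \<theta>\<^sub>s) < \<epsilon>} \<ge> 1 - \<delta>"
    if \<Omega>: "prob_space \<Omega>"
      and P: "\<forall>i\<in>{1..N}. \<forall>j\<in>{1..N}.
         prob_space (P i j) \<and> sets (P i j) = sets (borel_Rn m) \<and>
         \<eta> i j \<in> measurable \<Omega> (borel_Rn m) \<and> distr \<Omega> (borel_Rn m) (\<eta> i j) = P i j"
      and C: "C \<subseteq> Rn k" "C \<noteq> {}" "compact C"
      and U: "\<exists>U. openin (top_of_set (Rn k)) U \<and> C \<subseteq> U \<and>
         (\<forall>\<theta>\<in>U. \<forall>i\<in>{1..N}. \<forall>j\<in>{1..N}. integrable (P i j) (f \<theta>))"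
      and ind: "indep_off_shared_index \<Omega> m N \<eta>"
      and \<theta>\<^sub>s: "is_unique_arg_min_on (F_mean \<Omega> N f \<eta>) C \<theta>\<^sub>s"
      and \<theta>\<^sub>h: "\<forall>\<omega>\<in>space \<Omega>. is_unique_arg_min_on (F_hat N f \<eta> \<omega>) C (\<theta>\<^sub>h \<omega>)"
      and \<alpha>: "\<alpha> > 0" "strongly_convex_on \<alpha> C (F_mean \<Omega> N f \<eta>)"
      and M: "\<forall>\<theta>\<in>C. \<forall>i\<in>{1..N}. \<forall>j\<in>{1..N}.
         integrable (P i j) (\<lambda>y. exp \<bar>f \<theta> y - (\<integral>z. f \<theta> z \<partial>P i j)\<bar>) \<and>
         (\<integral>y. exp \<bar>f \<theta> y - (\<integral>z. f \<theta> z \<partial>P i j)\<bar> \<partial>P i j) < M"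
      and ex_g: "\<exists>g :: fseq \<Rightarrow> real.
         (\<forall>\<theta>\<in>C. \<forall>y\<in>Rn m. \<exists>D. has_gradient k (\<lambda>\<theta>'. f \<theta>' y) \<theta> D \<and> norm D \<le> g y) \<and>
         (\<forall>\<theta>\<in>C. \<forall>i\<in>{1..N}. \<forall>j\<in>{1..N}.
            integrable (P i j) g \<and>
            (\<exists>D. has_gradient k (\<lambda>\<theta>'. \<integral>y. f \<theta>' y \<partial>P i j) \<theta> D \<and> norm D \<le> (\<integral>y. g y \<partial>P i j)) \<and>
            integrable (P i j) (\<lambda>y. exp (g y)) \<and> (\<integral>y. exp (g y) \<partial>P i j) < L)"
      and \<epsilon>: "0 < \<epsilon>" "\<epsilon> < \<alpha> powr (-1/2)" and \<delta>: "0 < \<delta>" "\<delta> < 1"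
      and N_large: "real N > 4096 * M / (\<alpha>\<^sup>2 * \<epsilon>^4) *
           ln (3 / \<delta> * max 1 ((96 * sqrt (real k) * diameter C * L / (\<alpha> * \<epsilon>\<^sup>2)) ^ k))"
      and k: "k \<ge> 1" and N: "N \<ge> 1"
    for k m N and \<Omega> :: "'w measure" and f :: "fseq \<Rightarrow> fseq \<Rightarrow> real" and P \<eta> C \<alpha> M L \<theta>\<^sub>s \<theta>\<^sub>h \<epsilon> \<delta>
  proof -
    obtain g :: "fseq \<Rightarrow> real" where
      g1: "\<forall>\<theta>\<in>C. \<forall>y\<in>Rn m. \<exists>D. has_gradient k (\<lambda>\<theta>'. f \<theta>' y) \<theta> D \<and> norm D \<le> g y"
      and g2: "\<forall>\<theta>\<in>C. \<forall>i\<in>{1..N}. \<forall>j\<in>{1..N}.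
            integrable (P i j) g \<and>
            (\<exists>D. has_gradient k (\<lambda>\<theta>'. \<integral>y. f \<theta>' y \<partial>P i j) \<theta> D \<and> norm D \<le> (\<integral>y. g y \<partial>P i j)) \<and>
            integrable (P i j) (\<lambda>y. exp (g y)) \<and> (\<integral>y. exp (g y) \<partial>P i j) < L"
      using ex_g by blast
    obtain \<theta>0 where \<theta>0: "\<theta>0 \<in> C"
      using C(2) by blast
    have one: "1 \<in> {1..N}"
      using N by simp
    have f_int: "integrable (P i j) (f \<theta>)" if "\<theta> \<in> C" "i \<in> {1..N}" "j \<in> {1..N}" for \<theta> i j
      using U that by blast
    have \<eta>: "\<eta> i j \<in> measurable \<Omega> (borel_Rn m)" "distr \<Omega> (borel_Rn m) (\<eta> i j) = P i j"
        "sets (P i j) = sets (borel_Rn m)"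
      if "i \<in> {1..N}" "j \<in> {1..N}" for i j
      using P that by blast+
    have meas: "h \<in> borel_measurable (borel_Rn m)"
      if "i \<in> {1..N}" "j \<in> {1..N}" "integrable (P i j) h" for i j and h :: "fseq \<Rightarrow> real"
      using borel_measurable_integrable[OF that(3)] measurable_cong_sets[OF \<eta>(3)[OF that(1,2)] refl]
      by blast
    have int: "integrable \<Omega> (\<lambda>\<omega>. h (\<eta> i j \<omega>))" "(\<integral>\<omega>. h (\<eta> i j \<omega>) \<partial>\<Omega>) = (\<integral>y. h y \<partial>P i j)"
      if "i \<in> {1..N}" "j \<in> {1..N}" "integrable (P i j) h" for i j and h :: "fseq \<Rightarrow> real"
    proof -
      show "integrable \<Omega> (\<lambda>\<omega>. h (\<eta> i j \<omega>))"
        by (rule integrable_distr[OF \<eta>(1)[OF that(1,2)]]) (subst \<eta>(2)[OF that(1,2)], rule that(3))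
      show "(\<integral>\<omega>. h (\<eta> i j \<omega>) \<partial>\<Omega>) = (\<integral>y. h y \<partial>P i j)"
        by (subst \<eta>(2)[OF that(1,2), symmetric], rule integral_distr[OF \<eta>(1)[OF that(1,2)] meas[OF that], symmetric])
    qed
    \<comment> \<open>Since \<open>x \<le> exp x\<close>, the bound on the exponential moment of g
      also bounds its mean, so the same L is a Lipschitz constant of the expected objective.\<close>
    have mean_g: "(\<integral>y. g y \<partial>P i j) \<le> L" if "i \<in> {1..N}" "j \<in> {1..N}" for i j
    proof -
      have gi: "integrable (P i j) g" "integrable (P i j) (\<lambda>y. exp (g y))" "(\<integral>y. exp (g y) \<partial>P i j) < L"
        using g2 \<theta>0 that by blast+
      have "x \<le> exp x" for x :: real
        using exp_ge_add_one_self[of x] by linarith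
      then have "(\<integral>y. g y \<partial>P i j) \<le> (\<integral>y. exp (g y) \<partial>P i j)"
        by (intro integral_mono gi)
      then show ?thesis
        using gi(3) by linarith
    qed
    have "\<epsilon>\<^sup>2 < (\<alpha> powr (-1/2))\<^sup>2"
      using \<epsilon> by (intro power_strict_mono) auto
    also have "(\<alpha> powr (-1/2))\<^sup>2 = 1 / \<alpha>"
      unfolding power2_eq_square powr_add[symmetric] using powr_neg_one[OF \<alpha>(1)] by simp
    finally have \<alpha>\<epsilon>: "\<alpha> * \<epsilon>\<^sup>2 < 1"
      using \<alpha>(1) by (simp add: field_simps)
    show ?thesis
    proof (rule minimizer_concentration[where g=g and \<mu>="\<lambda>i j \<theta>. \<integral>y. f \<theta> y \<partial>P i j",
          OF \<Omega> N k \<eta>(1) ind C _ _ _ _ _ _ _ _ _ _ \<theta>\<^sub>s _ \<alpha> \<epsilon>(1) \<alpha>\<epsilon> \<delta> N_large])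
      show "\<exists>D. has_gradient k (\<lambda>\<theta>'. f \<theta>' y) \<theta> D \<and> norm D \<le> g y" if "\<theta> \<in> C" "y \<in> Rn m" for \<theta> y
        using g1 that by blast
      show "is_unique_arg_min_on (F_hat N f \<eta> \<omega>) C (\<theta>\<^sub>h \<omega>)" if "\<omega> \<in> space \<Omega>" for \<omega>
        using \<theta>\<^sub>h that by blast
      \<comment> \<open>All \<open>P i j\<close> share the sigma-algebra of
        \<open>borel_Rn m\<close>, so integrability under \<open>P 1 1\<close> already gives
        measurability.\<close>
      show "f \<theta> \<in> borel_measurable (borel_Rn m)" if "\<theta> \<in> C" for \<theta>
        using meas[OF one one f_int[OF that one one]] .
      show "g \<in> borel_measurable (borel_Rn m)"
        using meas[OF one one] g2 \<theta>0 one by blast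
      fix i j
      assume ij: "i \<in> {1..N}" "j \<in> {1..N}"
      have ge: "integrable (P i j) (\<lambda>y. exp (g y))" "(\<integral>y. exp (g y) \<partial>P i j) < L"
        using g2 \<theta>0 ij by blast+
      show "integrable \<Omega> (\<lambda>\<omega>. exp (g (\<eta> i j \<omega>)))" "(\<integral>\<omega>. exp (g (\<eta> i j \<omega>)) \<partial>\<Omega>) \<le> L"
        using int[OF ij ge(1)] ge(2) by auto
      fix \<theta> assume \<theta>: "\<theta> \<in> C"
      show "integrable \<Omega> (\<lambda>\<omega>. f \<theta> (\<eta> i j \<omega>))"
        "(\<integral>\<omega>. f \<theta> (\<eta> i j \<omega>) \<partial>\<Omega>) = (\<integral>y. f \<theta> y \<partial>P i j)"
        using int[OF ij f_int[OF \<theta> ij]] .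
      have fe: "integrable (P i j) (\<lambda>y. exp \<bar>f \<theta> y - (\<integral>z. f \<theta> z \<partial>P i j)\<bar>)"
         "(\<integral>y. exp \<bar>f \<theta> y - (\<integral>z. f \<theta> z \<partial>P i j)\<bar> \<partial>P i j) < M"
        using M \<theta> ij by blast+
      show "integrable \<Omega> (\<lambda>\<omega>. exp \<bar>f \<theta> (\<eta> i j \<omega>) - (\<integral>y. f \<theta> y \<partial>P i j)\<bar>)"
        "(\<integral>\<omega>. exp \<bar>f \<theta> (\<eta> i j \<omega>) - (\<integral>y. f \<theta> y \<partial>P i j)\<bar> \<partial>\<Omega>) \<le> M"
        using int[OF ij fe(1)] fe(2) by auto
      show "\<exists>D. has_gradient k (\<lambda>\<theta>. \<integral>y. f \<theta> y \<partial>P i j) \<theta> D \<and> norm D \<le> L"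
        using g2 \<theta> ij mean_g[OF ij] by (meson order_trans)
    qed
  qed
  show ?thesis
    by (rule exI[of _ 4096], rule conjI, simp, rule exI[of _ 96], rule conjI, simp,
        intro allI impI, elim conjE, rule main, assumption+)
qed

end
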